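(* Let $\varphi$ be a surjective symbol for $S(\mathbb{R})$ such that $C_{\varphi}:C^{\infty}(\mathbb{R})\to C^{\infty}(\mathbb{R})$, $f\mapsto f\circ\varphi$, has closed range. Assume there exist closed unbounded intervals $I_1$, $I_2\subset\mathbb{R}$ such that $\mathbb{R}\setminus (I_1\cup I_2)$ is bounded and the multiplication operator $M_{\varphi'}:S(I_j)\to S(I_j)$, $f\mapsto\varphi' f$, is well defined and has closed range for $j=1,2$. Then $C_{\varphi}:S(\mathbb{R})\to S(\mathbb{R})$, $f\mapsto f\circ\varphi$, also has closed range.
   Context: All functions are real-valued. $C^{\infty}(\mathbb{R})$ is the Fréchet space of smooth functions $\mathbb{R}\to\mathbb{R}$ with the topology of uniform convergence of all derivatives on compact sets. For $I=\mathbb{R}$ or $I\subset\mathbb{R}$ a closed unbounded interval (such as $[a,+\infty)$ or $(-\infty,a]$), $S(I)$ is the space of functions $f\in C^\infty(I)$ (with one-sided derivatives at a finite endpoint) such that $\sup_{x\in I}\sup_{0\leq j\leq n}(1+x^2)^n|f^{(j)}(x)|<\infty$ for each $n\in\mathbb{N}$, endowed with the Fréchet topology generated by these seminorms; $S(\mathbb{R})$ is the (real) Schwartz space. A function $\varphi\in C^\infty(\mathbb{R})$ is called a symbol for $S(\mathbb{R})$ if $f\circ\varphi\in S(\mathbb{R})$ whenever $f\in S(\mathbb{R})$. In $M_{\varphi'}:S(I)\to S(I)$ the function $\varphi'$ is restricted to $I$, and "well defined" means $\varphi' f\in S(I)$ for every $f\in S(I)$. An operator has closed range if its image is a closed subset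 of the target space. *)

theory Defs
  imports "HOL-Analysis.Analysis"
begin

text \<open>
  Derivatives are taken within \<open>I\<close>, hence are one-sided at a finite endpoint of an interval \<open>I\<close>
  and agree with \<^const>\<open>deriv\<close> for \<open>I = UNIV\<close>. On a nondegenerate interval, the values on \<open>I\<close> depend
  only on the values of \<open>f\<close> on \<open>I\<close>.
\<close>

primrec nth_deriv_within :: "real set \<Rightarrow> nat \<Rightarrow> (real \<Rightarrow> real) \<Rightarrow> real \<Rightarrow> real" where
  "nth_deriv_within I 0 f = f"
| "nth_deriv_within I (Suc n) f =
     (\<lambda>x. vector_derivative (nth_deriv_within I n f) (at x within I))"

text \<open>
  A function on \<open>I\<close> is represented by its extension with value \<^const>\<open>undefined\<close> outside \<open>I\<close>, so
  that equality of representatives is equality on \<open>I\<close>; for \<open>I = UNIV\<close> this is no restriction.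
\<close>

definition smooth_functions :: "real set \<Rightarrow> (real \<Rightarrow> real) set" where
  "smooth_functions I =
     {f \<in> extensional I. \<forall>n. nth_deriv_within I n f differentiable_on I}"

definition schwartz_weight ::
  "real set \<Rightarrow> nat \<Rightarrow> (real \<Rightarrow> real) \<Rightarrow> real \<times> nat \<Rightarrow> real" where
  "schwartz_weight I n f = (\<lambda>(x, j). (1 + x\<^sup>2) ^ n * \<bar>nth_deriv_within I j f x\<bar>)"

definition schwartz_seminorm :: "real set \<Rightarrow> nat \<Rightarrow> (real \<Rightarrow> real) \<Rightarrow> real" where
  "schwartz_seminorm I n f = (SUP xj \<in> I \<times> {0..n}. schwartz_weight I n f xj)"

text \<open>
  Finiteness of the seminorms has to be required through \<^const>\<open>bdd_above\<close>, because a real-valued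
  supremum of an unbounded set is an unspecified real number.
\<close>

definition schwartz_space :: "real set \<Rightarrow> (real \<Rightarrow> real) set" where
  "schwartz_space I =
     {f \<in> smooth_functions I. \<forall>n. bdd_above (schwartz_weight I n f ` (I \<times> {0..n}))}"

definition smooth_seminorm :: "real set \<Rightarrow> nat \<Rightarrow> (real \<Rightarrow> real) \<Rightarrow> real" where
  "smooth_seminorm K n f = (SUP x \<in> K. \<bar>nth_deriv_within UNIV n f x\<bar>)"

text \<open>
  The locally convex topology on \<open>X\<close> given by the family \<open>P\<close> of seminorms: the open balls of all
  \<open>p \<in> P\<close> form a subbasis.
\<close>

definition seminorm_topology ::
  "(real \<Rightarrow> real) set \<Rightarrow> ((real \<Rightarrow> real) \<Rightarrow> real) set \<Rightarrow> (real \<Rightarrow> real) topology" where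
  "seminorm_topology X P =
     topology_generated_by
       {{g \<in> X. p (\<lambda>x. g x - f x) < e} | p f e. p \<in> P \<and> f \<in> X \<and> 0 < e}"

definition smooth_topology :: "(real \<Rightarrow> real) topology" where
  "smooth_topology =
     seminorm_topology (smooth_functions UNIV) {smooth_seminorm K n | K n. compact K \<and> K \<noteq> {}}"

definition schwartz_topology :: "real set \<Rightarrow> (real \<Rightarrow> real) topology" where
  "schwartz_topology I =
     seminorm_topology (schwartz_space I) (range (schwartz_seminorm I))"

definition composition_operator :: "(real \<Rightarrow> real) \<Rightarrow> (real \<Rightarrow> real) \<Rightarrow> (real \<Rightarrow> real)" where
  "composition_operator \<phi> f = f \<circ> \<phi>"

definition multiplication_operator ::
  "real set \<Rightarrow> (real \<Rightarrow> real) \<Rightarrow> (real \<Rightarrow> real) \<Rightarrow> (real \<Rightarrow> real)" where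
  "multiplication_operator I m f = (\<lambda>x\<in>I. m x * f x)"

definition schwartz_symbol :: "(real \<Rightarrow> real) \<Rightarrow> bool" where
  "schwartz_symbol \<phi> \<longleftrightarrow>
     \<phi> \<in> smooth_functions UNIV \<and> (\<forall>f \<in> schwartz_space UNIV. f \<circ> \<phi> \<in> schwartz_space UNIV)"

definition closed_unbounded_interval :: "real set \<Rightarrow> bool" where
  "closed_unbounded_interval I \<longleftrightarrow> is_interval I \<and> closed I \<and> \<not> bounded I"

lemma topspace_seminorm_topology:
  assumes "P \<noteq> {}" "\<And>p. p \<in> P \<Longrightarrow> p (\<lambda>x. 0) = 0"
  shows "topspace (seminorm_topology X P) = X"
proof -
  from assms obtain p where p: "p \<in> P" "p (\<lambda>x. 0) = 0" by blast
  have "f \<in> \<Union>{{g \<in> X. p (\<lambda>x. g x - f x) < e} | p f e. p \<in> P \<and> f \<in> X \<and> 0 < e}"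
    if "f \<in> X" for f
  proof (rule UnionI)
    show "{g \<in> X. p (\<lambda>x. g x - f x) < 1} \<in>
        {{g \<in> X. p (\<lambda>x. g x - f x) < e} | p f e. p \<in> P \<and> f \<in> X \<and> (0::real) < e}"
      using p(1) that zero_less_one by blast
    show "f \<in> {g \<in> X. p (\<lambda>x. g x - f x) < 1}" using p that by simp
  qed
  then show ?thesis
    unfolding seminorm_topology_def topology_generated_by_topspace by blast
qed

lemma nth_deriv_within_zero:
  assumes I: "\<And>x. x \<in> I \<Longrightarrow> at x within I \<noteq> bot" and x: "x \<in> I"
  shows "nth_deriv_within I n (\<lambda>x. 0) x = 0"
  using x
proof (induction n arbitrary: x)
  case (Suc n)
  have "((\<lambda>x. 0) has_vector_derivative 0) (at x within I)" by simp
  then have "(nth_deriv_within I n (\<lambda>x. 0) has_vector_derivative 0) (at x within I)"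
    using Suc by (simp add: has_vector_derivative_transform)
  then show ?case
    using I[OF Suc.prems] by (simp add: vector_derivative_within)
qed simp

lemma topspace_smooth_topology: "topspace smooth_topology = smooth_functions UNIV"
proof -
  have "smooth_seminorm K n (\<lambda>x. 0) = 0" if "K \<noteq> {}" for K n
    using that by (simp add: smooth_seminorm_def nth_deriv_within_zero)
  moreover have "compact {0::real}" by simp
  ultimately show ?thesis
    unfolding smooth_topology_def by (intro topspace_seminorm_topology) blast+
qed

lemma topspace_schwartz_topology:
  assumes "closed_unbounded_interval I"
  shows "topspace (schwartz_topology I) = schwartz_space I"
proof -
  from assms have I: "connected I" "\<not> bounded I"
    by (auto simp: closed_unbounded_interval_def is_interval_connected)
  have "I \<noteq> {}" using I(2) by auto
  have "at x within I \<noteq> bot" if "x \<in> I" for x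
  proof -
    have "I \<noteq> {x}" using I(2) by auto
    then have "x islimpt I"
      using connected_imp_perfect[OF I(1)] that by auto
    then show ?thesis by (simp add: trivial_limit_within)
  qed
  then have "schwartz_weight I n (\<lambda>x. 0) xj = 0" if "xj \<in> I \<times> {0..n}" for n xj
    using that by (auto simp: schwartz_weight_def nth_deriv_within_zero)
  then have "schwartz_seminorm I n (\<lambda>x. 0) = 0" for n
    using \<open>I \<noteq> {}\<close> by (simp add: schwartz_seminorm_def cong: SUP_cong_simp)
  then show ?thesis
    unfolding schwartz_topology_def by (intro topspace_seminorm_topology) auto
qed

end

theory Submission
  imports Defs
begin

text \<open>
  Since \<open>S(\<real>)\<close> embeds continuously into \<open>C\<^sup>\<infinity>(\<real>)\<close>, it suffices that \<open>F \<circ> \<phi> \<in> S(\<real>)\<close> with \<open>F\<close>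
  smooth implies \<open>F \<in> S(\<real>)\<close>. The function \<open>(F \<circ> \<phi>)'\<close> is the limit in \<open>S(I)\<close> of the products of
  \<open>\<phi>'\<close> with the cut-off functions \<open>(F' \<circ> \<phi>) \<cdot> \<eta>(x / n)\<close>; as the range of \<open>M\<^sub>\<phi>\<^sub>'\<close> is closed, it is
  \<open>\<phi>' h\<close> for some \<open>h \<in> S(I)\<close>, and \<open>h = F' \<circ> \<phi>\<close> wherever \<open>\<phi>' \<noteq> 0\<close>. This gives \<open>F' \<circ> \<phi> \<in> S(\<real>)\<close>, and
  by iteration \<open>F\<^sup>(\<^sup>k\<^sup>) \<circ> \<phi> \<in> S(\<real>)\<close> for all \<open>k\<close>. Because \<open>M\<^sub>\<phi>\<^sub>'\<close> is well defined, \<open>\<phi>'\<close> and hence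
  \<open>\<phi>\<close> grow at most polynomially, so by surjectivity the decay of \<open>F\<^sup>(\<^sup>k\<^sup>) \<circ> \<phi>\<close> is one of \<open>F\<^sup>(\<^sup>k\<^sup>)\<close>.
\<close>

section \<open>Smooth functions\<close>

text \<open>Counting the order of differentiability lets closure under sums, products and
  compositions be proved by induction on \<open>n\<close>: the derivative of such an expression is
  built from functions that are known to be differentiable up to order \<open>n\<close>.\<close>

primrec differentiable_upto :: "nat \<Rightarrow> (real \<Rightarrow> real) \<Rightarrow> bool" where
  "differentiable_upto 0 f \<longleftrightarrow> True"
| "differentiable_upto (Suc n) f \<longleftrightarrow>
     (\<forall>x. f differentiable at x) \<and> differentiable_upto n (deriv f)"

definition smooth :: "(real \<Rightarrow> real) \<Rightarrow> bool" where
  "smooth f \<longleftrightarrow> (\<forall>n. differentiable_upto n f)"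

text \<open>Both derivatives are chosen values of equivalent predicates, so they agree even at
  points where \<open>f\<close> is not differentiable.\<close>

lemma vector_derivative_eq_deriv: "vector_derivative f (at x) = deriv f x"
  for f :: "real \<Rightarrow> real"
  by (simp add: vector_derivative_def deriv_def has_real_derivative_iff_has_vector_derivative)

lemma nth_deriv_within_UNIV: "nth_deriv_within UNIV n f = (deriv ^^ n) f"
  by (induction n) (simp_all add: vector_derivative_eq_deriv)

lemma differentiable_upto_iff:
  "differentiable_upto n f \<longleftrightarrow> (\<forall>i<n. \<forall>x. (deriv ^^ i) f differentiable at x)"
proof (induction n arbitrary: f)
  case (Suc n)
  have "(deriv ^^ i) (deriv f) = (deriv ^^ Suc i) f" for i
    by (simp add: funpow_swap1)
  then show ?case
    by (simp add: Suc All_less_Suc2 del: funpow.simps(2))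
qed simp

lemma smooth_iff: "smooth f \<longleftrightarrow> (\<forall>n x. (deriv ^^ n) f differentiable at x)"
  unfolding smooth_def differentiable_upto_iff by blast

lemma smooth_functions_UNIV: "f \<in> smooth_functions UNIV \<longleftrightarrow> smooth f"
  by (simp add: smooth_functions_def nth_deriv_within_UNIV smooth_iff differentiable_on_def)

lemma smooth_funpow_deriv: "smooth f \<Longrightarrow> smooth ((deriv ^^ n) f)"
  by (auto simp: smooth_iff funpow_add[THEN fun_cong, unfolded comp_apply, symmetric])

lemma smooth_deriv: "smooth f \<Longrightarrow> smooth (deriv f)"
  using smooth_funpow_deriv[of f 1] by simp

lemma smooth_has_derivative:
  "smooth f \<Longrightarrow> ((deriv ^^ n) f has_real_derivative (deriv ^^ Suc n) f x) (at x)"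
  by (simp add: smooth_iff differentiable_def DERIV_deriv_iff_real_differentiable)

lemma smooth_DERIV: "smooth f \<Longrightarrow> (f has_real_derivative deriv f x) (at x)"
  using smooth_has_derivative[of f 0] by simp

lemma smooth_continuous_on: "smooth f \<Longrightarrow> continuous_on A ((deriv ^^ n) f)"
  by (meson DERIV_continuous_on has_field_derivative_at_within smooth_has_derivative)

lemma differentiable_upto_mono: "differentiable_upto n f \<Longrightarrow> m \<le> n \<Longrightarrow> differentiable_upto m f"
  by (auto simp: differentiable_upto_iff)

lemma differentiable_upto_SucI:
  assumes "\<And>x. (f has_real_derivative f' x) (at x)" "differentiable_upto n f'"
  shows "differentiable_upto (Suc n) f"
proof -
  have "deriv f = f'"
    using assms(1) by (auto intro!: ext DERIV_imp_deriv)
  then show ?thesis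
    using assms by (auto simp: real_differentiable_def)
qed

lemma differentiable_upto_SucD:
  assumes "differentiable_upto (Suc n) f"
  shows "(f has_real_derivative deriv f x) (at x)" "differentiable_upto n (deriv f)"
    "differentiable_upto n f"
  using assms differentiable_upto_mono[OF assms, of n]
  by (auto simp: DERIV_deriv_iff_real_differentiable)

lemma differentiable_upto_const: "differentiable_upto n (\<lambda>x. c)"
proof (induction n arbitrary: c)
  case (Suc n)
  show ?case
    by (rule differentiable_upto_SucI[where f' = "\<lambda>x. 0"]) (auto intro: Suc)
qed simp

lemma differentiable_upto_linear: "differentiable_upto n (\<lambda>x. a * x + b)"
proof (cases n)
  case (Suc m)
  show ?thesis
    unfolding Suc
    by (rule differentiable_upto_SucI[where f' = "\<lambda>x. a"])
       (auto intro!: derivative_eq_intros differentiable_upto_const)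
qed simp

lemma differentiable_upto_add:
  "differentiable_upto n f \<Longrightarrow> differentiable_upto n g \<Longrightarrow> differentiable_upto n (\<lambda>x. f x + g x)"
proof (induction n arbitrary: f g)
  case (Suc n)
  note f = differentiable_upto_SucD[OF Suc.prems(1)] and g = differentiable_upto_SucD[OF Suc.prems(2)]
  show ?case
    by (rule differentiable_upto_SucI[where f' = "\<lambda>x. deriv f x + deriv g x"])
       (simp_all add: DERIV_add f(1) g(1) Suc.IH[OF f(2) g(2)])
qed simp

lemma differentiable_upto_mult:
  "differentiable_upto n f \<Longrightarrow> differentiable_upto n g \<Longrightarrow> differentiable_upto n (\<lambda>x. f x * g x)"
proof (induction n arbitrary: f g)
  case (Suc n)
  note f = differentiable_upto_SucD[OF Suc.prems(1)] and g = differentiable_upto_SucD[OF Suc.prems(2)]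
  show ?case
    by (rule differentiable_upto_SucI[where f' = "\<lambda>x. deriv f x * g x + deriv g x * f x"])
       (simp_all add: DERIV_mult f(1) g(1) differentiable_upto_add Suc.IH[OF f(2) g(3)] Suc.IH[OF g(2) f(3)])
qed simp

lemma differentiable_upto_compose:
  "differentiable_upto n f \<Longrightarrow> differentiable_upto n g \<Longrightarrow> differentiable_upto n (\<lambda>x. f (g x))"
proof (induction n arbitrary: f g)
  case (Suc n)
  note f = differentiable_upto_SucD[OF Suc.prems(1)] and g = differentiable_upto_SucD[OF Suc.prems(2)]
  show ?case
    by (rule differentiable_upto_SucI[where f' = "\<lambda>x. deriv f (g x) * deriv g x"])
       (simp_all add: DERIV_chain2[OF f(1) g(1)] differentiable_upto_mult[OF Suc.IH[OF f(2) g(3)] g(2)])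
qed simp

lemma smooth_const: "smooth (\<lambda>x. c)"
  and smooth_linear: "smooth (\<lambda>x. a * x + b)"
  and smooth_add: "smooth f \<Longrightarrow> smooth g \<Longrightarrow> smooth (\<lambda>x. f x + g x)"
  and smooth_mult: "smooth f \<Longrightarrow> smooth g \<Longrightarrow> smooth (\<lambda>x. f x * g x)"
  and smooth_compose: "smooth f \<Longrightarrow> smooth g \<Longrightarrow> smooth (\<lambda>x. f (g x))"
  by (simp_all add: smooth_def differentiable_upto_const differentiable_upto_linear
      differentiable_upto_add differentiable_upto_mult differentiable_upto_compose)

lemma smooth_scale: "smooth f \<Longrightarrow> smooth (\<lambda>x. f (a * x + b))"
  by (rule smooth_compose[OF _ smooth_linear])

lemma smooth_diff: "smooth f \<Longrightarrow> smooth g \<Longrightarrow> smooth (\<lambda>x. f x - g x)"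
  using smooth_add[OF _ smooth_mult[OF smooth_const[of "-1"]], of f g] by simp

text \<open>Serves to read off all iterated derivatives at once from an explicit candidate family
  \<open>G\<close>, here for sums, multiples, affine substitutions and a series.\<close>

lemma funpow_deriv_eqI:
  assumes "\<And>j x. (G j has_real_derivative G (Suc j) x) (at x)"
  shows "(deriv ^^ j) (G 0) = G j"
  by (induction j) (auto intro!: ext DERIV_imp_deriv assms)

lemma smoothI:
  assumes "\<And>j x. (G j has_real_derivative G (Suc j) x) (at x)"
  shows "smooth (G 0)"
  using assms by (auto simp: smooth_iff funpow_deriv_eqI[of G, OF assms] real_differentiable_def)

lemma funpow_deriv_add:
  assumes "smooth f" "smooth g"
  shows "(deriv ^^ j) (\<lambda>x. f x + g x) x = (deriv ^^ j) f x + (deriv ^^ j) g x"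
  using funpow_deriv_eqI[of "\<lambda>j x. (deriv ^^ j) f x + (deriv ^^ j) g x" j]
    DERIV_add[OF smooth_has_derivative[OF assms(1)] smooth_has_derivative[OF assms(2)]]
  by simp

lemma funpow_deriv_cmult:
  assumes "smooth f"
  shows "(deriv ^^ j) (\<lambda>x. c * f x) x = c * (deriv ^^ j) f x"
  using funpow_deriv_eqI[of "\<lambda>j x. c * (deriv ^^ j) f x" j]
    DERIV_cmult[OF smooth_has_derivative[OF assms(1)]]
  by simp

lemma funpow_deriv_scale:
  assumes "smooth f"
  shows "(deriv ^^ j) (\<lambda>x. f (a * x + b)) x = a ^ j * (deriv ^^ j) f (a * x + b)"
proof -
  have "((\<lambda>x. a ^ i * (deriv ^^ i) f (a * x + b)) has_real_derivative
      a ^ Suc i * (deriv ^^ Suc i) f (a * x + b)) (at x)" for i x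
  proof -
    have "((\<lambda>x. a * x + b) has_real_derivative a) (at x)"
      by (auto intro!: derivative_eq_intros)
    from DERIV_cmult[OF DERIV_chain2[OF smooth_has_derivative[OF assms] this], of "a ^ i" i]
    show ?thesis by (simp add: mult_ac)
  qed
  from funpow_deriv_eqI[of "\<lambda>i x. a ^ i * (deriv ^^ i) f (a * x + b)", OF this, of j]
  show ?thesis by simp
qed

text \<open>A derivative depends only on the germ of the function. The induction runs over all
  points of \<open>W\<close>, since the next derivative at \<open>x\<close> needs equality of the
  previous ones near \<open>x\<close>.\<close>

lemma funpow_deriv_cong_open:
  assumes "open W" "x \<in> W" "\<And>y. y \<in> W \<Longrightarrow> f y = g y"
  shows "(deriv ^^ j) f x = (deriv ^^ j) g x"
  using assms(2)
proof (induction j arbitrary: x)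
  case (Suc j)
  have "\<forall>\<^sub>F y in nhds x. (deriv ^^ j) f y = (deriv ^^ j) g y"
    using Suc assms(1) by (auto simp: eventually_nhds)
  then show ?case
    by (simp add: deriv_cong_ev)
qed (use assms(3) in simp)

lemma funpow_deriv_const: "(deriv ^^ j) (\<lambda>x. c) x = (if j = 0 then c else 0 :: real)"
  using funpow_deriv_eqI[of "\<lambda>j x. if j = 0 then c else 0" j] by simp

section \<open>A bump function\<close>

text \<open>The classical flat function \<open>exp (- (1 / x))\<close> with a power of
  \<open>1 / x\<close> as a factor. The exponent is a parameter because the span of the whole family
  is closed under differentiation.\<close>

definition flat_exp :: "nat \<Rightarrow> real \<Rightarrow> real" where
  "flat_exp k x = (if x > 0 then (1 / x) ^ k * exp (- (1 / x)) else 0)"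

lemma flat_exp_tendsto_0: "(flat_exp k \<longlongrightarrow> 0) (at 0)"
proof -
  have "((\<lambda>x. (1 / x) ^ k * exp (- (1 / x)) :: real) \<longlongrightarrow> 0) (at_right 0)"
  proof -
    have "((\<lambda>y. y ^ k / exp y) \<longlongrightarrow> (0::real)) at_top"
      by (rule tendsto_power_div_exp_0)
    from filterlim_compose[OF this filterlim_inverse_at_top_right] show ?thesis
      by (simp add: field_simps exp_minus)
  qed
  moreover have "\<forall>\<^sub>F x in at_right 0. (1 / x) ^ k * exp (- (1 / x)) = flat_exp k x"
    by (auto simp: flat_exp_def eventually_at_right_field intro: exI[of _ 1])
  ultimately have "(flat_exp k \<longlongrightarrow> 0) (at_right 0)"
    by (rule Lim_transform_eventually)
  moreover have "(flat_exp k \<longlongrightarrow> 0) (at_left 0)"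
    by (rule Lim_transform_eventually[OF tendsto_const])
       (auto simp: flat_exp_def eventually_at_left_field intro: exI[of _ "-1"])
  ultimately show ?thesis
    by (simp add: filterlim_split_at)
qed

lemma flat_exp_DERIV:
  "(flat_exp k has_real_derivative flat_exp (Suc (Suc k)) x - real k * flat_exp (Suc k) x) (at x)"
proof -
  consider "x < 0" | "x = 0" | "x > 0" by linarith
  then show ?thesis
  proof cases
    case 1
    have "((\<lambda>x. 0) has_real_derivative 0) (at x)" by simp
    then have "(flat_exp k has_real_derivative 0) (at x)"
      by (rule has_field_derivative_transform_within_open[of _ _ _ "{..<0}"])
         (use 1 in \<open>auto simp: flat_exp_def\<close>)
    then show ?thesis using 1 by (simp add: flat_exp_def)
  next
    case 2
    \<comment> \<open>The difference quotient of \<open>flat_exp k\<close> at 0 is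
      \<open>flat_exp (Suc k)\<close>, so its limit is the one already computed.\<close>
    have "\<forall>\<^sub>F h in at 0. flat_exp (Suc k) h = (flat_exp k (0 + h) - flat_exp k 0) / h"
      by (rule eventuallyI) (simp add: flat_exp_def)
    from Lim_transform_eventually[OF flat_exp_tendsto_0 this] show ?thesis
      using 2 by (simp add: DERIV_def flat_exp_def)
  next
    case 3
    have inv: "((\<lambda>x. 1 / x) has_real_derivative (- ((1 / x) ^ 2))) (at x)"
      using 3 by (auto intro!: derivative_eq_intros simp: field_simps power2_eq_square)
    have "((\<lambda>y. y ^ k * exp (- y)) has_real_derivative
        real k * y ^ (k - 1) * exp (- y) - y ^ k * exp (- y)) (at y)" for y :: real
      by (auto intro!: derivative_eq_intros)
    from DERIV_chain2[OF this inv] have "((\<lambda>x. (1 / x) ^ k * exp (- (1 / x))) has_real_derivative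
        (real k * (1 / x) ^ (k - 1) * exp (- (1 / x)) - (1 / x) ^ k * exp (- (1 / x))) * (- ((1 / x) ^ 2))) (at x)" .
    also have "(real k * (1 / x) ^ (k - 1) * exp (- (1 / x)) - (1 / x) ^ k * exp (- (1 / x))) * (- ((1 / x) ^ 2)) =
        flat_exp (Suc (Suc k)) x - real k * flat_exp (Suc k) x"
      using 3 by (cases k) (simp_all add: flat_exp_def power2_eq_square algebra_simps add_divide_distrib)
    finally have "((\<lambda>x. (1 / x) ^ k * exp (- (1 / x))) has_real_derivative
        flat_exp (Suc (Suc k)) x - real k * flat_exp (Suc k) x) (at x)" .
    then show ?thesis
      by (rule has_field_derivative_transform_within_open[of _ _ _ "{0<..}"])
         (use 3 in \<open>auto simp: flat_exp_def\<close>)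
  qed
qed

lemma smooth_flat_exp: "smooth (flat_exp k)"
proof -
  have "differentiable_upto n (flat_exp k)" for n
  proof (induction n arbitrary: k)
    case (Suc n)
    have "differentiable_upto n (\<lambda>x. flat_exp (Suc (Suc k)) x + (- real k) * flat_exp (Suc k) x)"
      by (intro differentiable_upto_add differentiable_upto_mult differentiable_upto_const Suc)
    then show ?case
      by (intro differentiable_upto_SucI[OF flat_exp_DERIV]) simp
  qed simp
  then show ?thesis by (simp add: smooth_def)
qed

text \<open>A nonnegative bump that vanishes outside the interval from -1 to 1. The factor
  \<open>exp 2\<close> normalizes its value at 0 to 1; it serves as a cut-off function and as the
  building block of a series.\<close>

definition bump :: "real \<Rightarrow> real" where
  "bump x = exp 2 * (flat_exp 0 (1 + x) * flat_exp 0 (1 - x))"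

lemma smooth_bump: "smooth bump"
proof -
  have "smooth (\<lambda>x. exp 2 * (flat_exp 0 (1 * x + 1) * flat_exp 0 ((-1) * x + 1)))"
    by (intro smooth_mult smooth_const smooth_scale smooth_flat_exp)
  also have "(\<lambda>x. exp 2 * (flat_exp 0 (1 * x + 1) * flat_exp 0 ((-1) * x + 1))) = bump"
    by (simp add: bump_def fun_eq_iff add.commute)
  finally show ?thesis .
qed

lemma bump_0: "bump 0 = 1"
  by (simp add: bump_def flat_exp_def flip: exp_add)

lemma bump_nonneg: "0 \<le> bump x"
  by (simp add: bump_def flat_exp_def)

lemma bump_eq_0: "1 \<le> \<bar>x\<bar> \<Longrightarrow> bump x = 0"
  unfolding bump_def flat_exp_def by (cases "x \<le> 0") auto

lemma funpow_deriv_eq_0_outside: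
  assumes "\<And>x. r \<le> \<bar>x\<bar> \<Longrightarrow> f x = 0" "r < \<bar>x\<bar>"
  shows "(deriv ^^ j) f x = (0::real)"
proof -
  have "open {x::real. r < \<bar>x\<bar>}"
    by (intro open_Collect_less continuous_intros)
  from funpow_deriv_cong_open[OF this, of x f "\<lambda>_. 0" j] show ?thesis
    using assms by (simp add: funpow_deriv_const)
qed

lemma compact_support_bound:
  fixes w :: "real \<Rightarrow> real"
  assumes "smooth f" "\<And>x. r \<le> \<bar>x\<bar> \<Longrightarrow> f x = 0" "continuous_on UNIV w"
  shows "\<exists>C. \<forall>x. w x * \<bar>(deriv ^^ j) f x\<bar> \<le> C"
proof -
  have "continuous_on {-r..r} (\<lambda>x. w x * \<bar>(deriv ^^ j) f x\<bar>)"
    by (intro continuous_on_mult continuous_on_rabs smooth_continuous_on[OF assms(1)]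
        continuous_on_subset[OF assms(3)]) simp
  then have "compact ((\<lambda>x. w x * \<bar>(deriv ^^ j) f x\<bar>) ` {-r..r})"
    by (rule compact_continuous_image) simp
  then obtain B where B: "\<forall>x\<in>{-r..r}. \<bar>w x * \<bar>(deriv ^^ j) f x\<bar>\<bar> \<le> B"
    by (auto dest!: compact_imp_bounded simp: bounded_iff simp del: atLeastAtMost_iff)
  \<comment> \<open>The value 0 covers the points outside the interval; for negative
    \<open>r\<close> the interval is empty and \<open>B\<close> says nothing.\<close>
  have "w x * \<bar>(deriv ^^ j) f x\<bar> \<le> max B 0" for x
  proof (cases "r < \<bar>x\<bar>")
    case True
    then show ?thesis using funpow_deriv_eq_0_outside[OF assms(2) True] by simp
  next
    case False
    then have "x \<in> {-r..r}" by auto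
    from B[rule_format, OF this] show ?thesis by linarith
  qed
  then show ?thesis by blast
qed

section \<open>Schwartz functions\<close>

lemma at_within_closed_unbounded_interval:
  assumes "closed_unbounded_interval I" "x \<in> I"
  shows "at x within I \<noteq> bot"
proof -
  \<comment> \<open>Derivatives within \<open>I\<close> are determined only at limit points of
    \<open>I\<close>; a connected set with more than one point consists of limit points.\<close>
  have "I \<noteq> {x}"
    using assms(1) by (auto simp: closed_unbounded_interval_def)
  then show ?thesis
    using assms connected_imp_perfect[of I x]
    by (auto simp: closed_unbounded_interval_def is_interval_connected trivial_limit_within)
qed

lemma closed_unbounded_interval_UNIV: "closed_unbounded_interval UNIV"
  by (simp add: closed_unbounded_interval_def)

text \<open>The set \<open>W\<close> covers two situations: \<open>W = I\<close>, for restrictions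
  of functions on the line, and \<open>W\<close> open in the line, for functions on \<open>I\<close>
  known to agree with \<open>u\<close> on an open part only.\<close>

lemma nth_deriv_within_eq:
  assumes u: "smooth u" and W: "W \<subseteq> I"
    "\<And>y. y \<in> W \<Longrightarrow> at y within I = at y within W \<and> at y within W \<noteq> bot"
    and eq: "\<And>y. y \<in> W \<Longrightarrow> f y = u y" and "x \<in> W"
  shows "nth_deriv_within I n f x = (deriv ^^ n) u x"
  using \<open>x \<in> W\<close>
proof (induction n arbitrary: x)
  case (Suc n)
  have "((deriv ^^ n) u has_vector_derivative (deriv ^^ Suc n) u x) (at x within W)"
    using smooth_has_derivative[OF u]
    by (metis has_real_derivative_iff_has_vector_derivative has_vector_derivative_at_within)
  then have "(nth_deriv_within I n f has_vector_derivative (deriv ^^ Suc n) u x) (at x within I)"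
    using Suc W(2)[OF Suc.prems]
    by (simp add: has_vector_derivative_transform del: funpow.simps(2))
  then show ?case
    using W(2)[OF Suc.prems] by (simp add: vector_derivative_within del: funpow.simps(2))
qed (use eq in simp)

lemma nth_deriv_within_eq_interval:
  assumes "smooth u" "closed_unbounded_interval I" "\<And>y. y \<in> I \<Longrightarrow> f y = u y" "x \<in> I"
  shows "nth_deriv_within I n f x = (deriv ^^ n) u x"
  using nth_deriv_within_eq[OF assms(1) order_refl _ assms(3,4)]
    at_within_closed_unbounded_interval[OF assms(2)] by blast

lemma nth_deriv_within_eq_open:
  fixes I W :: "real set"
  assumes "smooth u" "open W" "W \<subseteq> I" "\<And>y. y \<in> W \<Longrightarrow> f y = u y" "x \<in> W"
  shows "nth_deriv_within I n f x = (deriv ^^ n) u x"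
proof (rule nth_deriv_within_eq[OF assms(1,3) _ assms(4,5)])
  fix y assume "y \<in> W"
  then show "at y within I = at y within W \<and> at y within W \<noteq> bot"
    using at_within_open_subset[OF _ assms(2,3)] at_within_open[OF _ assms(2)] by simp
qed

lemma restrict_smooth_functions:
  assumes "smooth u" "closed_unbounded_interval I"
  shows "restrict u I \<in> smooth_functions I"
proof -
  have "nth_deriv_within I n (restrict u I) differentiable_on I" for n
    unfolding differentiable_on_def
  proof
    fix x assume x: "x \<in> I"
    have "(deriv ^^ n) u differentiable (at x within I)"
      using assms(1) by (simp add: smooth_iff differentiable_at_withinI)
    then show "nth_deriv_within I n (restrict u I) differentiable (at x within I)"
      by (rule differentiable_transform_within[OF _ zero_less_one x])
         (simp add: nth_deriv_within_eq_interval[OF assms])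
  qed
  then show ?thesis
    by (simp add: smooth_functions_def)
qed

text \<open>Separates the exponent of the weight from the order of the derivative. In one direction
  the seminorm of index \<open>max n j\<close> dominates both; in the other, finitely many bounds
  are added up.\<close>

lemma schwartz_space_iff:
  "f \<in> schwartz_space I \<longleftrightarrow> f \<in> smooth_functions I \<and>
     (\<forall>n j. \<exists>C. \<forall>x\<in>I. (1 + x\<^sup>2) ^ n * \<bar>nth_deriv_within I j f x\<bar> \<le> C)"
proof -
  have bound_weight: "\<exists>C. \<forall>x\<in>I. (1 + x\<^sup>2) ^ n * \<bar>nth_deriv_within I j f x\<bar> \<le> C"
    if b: "\<forall>n. bdd_above (schwartz_weight I n f ` (I \<times> {0..n}))" for n j
  proof -
    obtain C where C: "\<forall>x\<in>I. \<forall>i\<in>{0..max n j}. schwartz_weight I (max n j) f (x, i) \<le> C"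
      using b[rule_format, of "max n j"] by (auto simp: bdd_above_def)
    have "(1 + x\<^sup>2) ^ n * \<bar>nth_deriv_within I j f x\<bar> \<le> C" if "x \<in> I" for x
    proof -
      have "(1 + x\<^sup>2) ^ n * \<bar>nth_deriv_within I j f x\<bar> \<le> (1 + x\<^sup>2) ^ max n j * \<bar>nth_deriv_within I j f x\<bar>"
        by (intro mult_right_mono power_increasing) auto
      also have "\<dots> \<le> C" using C[rule_format, OF that, of j] by (simp add: schwartz_weight_def)
      finally show ?thesis .
    qed
    then show ?thesis by blast
  qed
  have bdd_weight: "bdd_above (schwartz_weight I n f ` (I \<times> {0..n}))"
    if b: "\<forall>n j. \<exists>C. \<forall>x\<in>I. (1 + x\<^sup>2) ^ n * \<bar>nth_deriv_within I j f x\<bar> \<le> C" for n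
  proof -
    obtain C where C: "\<And>j x. x \<in> I \<Longrightarrow> (1 + x\<^sup>2) ^ n * \<bar>nth_deriv_within I j f x\<bar> \<le> C j"
      using b by metis
    show ?thesis
    proof (rule bdd_aboveI)
      fix y assume "y \<in> schwartz_weight I n f ` (I \<times> {0..n})"
      then obtain x j where y: "x \<in> I" "j \<le> n" "y = schwartz_weight I n f (x, j)"
        by auto
      then have "y \<le> \<bar>C j\<bar>"
        using C[OF y(1), of j] by (simp add: schwartz_weight_def)
      also have "\<dots> \<le> (\<Sum>j\<le>n. \<bar>C j\<bar>)"
        using y(2) by (intro member_le_sum) auto
      finally show "y \<le> (\<Sum>j\<le>n. \<bar>C j\<bar>)" .
    qed
  qed
  show ?thesis
    unfolding schwartz_space_def mem_Collect_eq
    by (rule conj_cong[OF refl], rule iffI) (rule allI, (rule allI)?, erule bound_weight bdd_weight)+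
qed

lemma schwartz_space_UNIV_iff:
  "f \<in> schwartz_space UNIV \<longleftrightarrow>
     smooth f \<and> (\<forall>n j. \<exists>C. \<forall>x. (1 + x\<^sup>2) ^ n * \<bar>(deriv ^^ j) f x\<bar> \<le> C)"
  by (simp add: schwartz_space_iff smooth_functions_UNIV nth_deriv_within_UNIV)

lemma restrict_schwartz_space:
  assumes "u \<in> schwartz_space UNIV" "closed_unbounded_interval I"
  shows "restrict u I \<in> schwartz_space I"
proof -
  have u: "smooth u" and C: "\<And>n j. \<exists>C. \<forall>x. (1 + x\<^sup>2) ^ n * \<bar>(deriv ^^ j) u x\<bar> \<le> C"
    using assms(1) by (auto simp only: schwartz_space_UNIV_iff)
  have "\<exists>C. \<forall>x\<in>I. (1 + x\<^sup>2) ^ n * \<bar>nth_deriv_within I j (restrict u I) x\<bar> \<le> C" for n j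
    using C[of n j] nth_deriv_within_eq_interval[OF u assms(2), of "restrict u I" _ j] by auto
  then show ?thesis
    using restrict_smooth_functions[OF u assms(2)] by (simp only: schwartz_space_iff) blast
qed

lemma funpow_deriv_Suc: "(deriv ^^ Suc j) f = (deriv ^^ j) (deriv f)"
  by (simp add: funpow_swap1)

lemma schwartz_space_deriv:
  assumes "f \<in> schwartz_space UNIV"
  shows "deriv f \<in> schwartz_space UNIV"
proof -
  have "\<exists>C. \<forall>x. (1 + x\<^sup>2) ^ n * \<bar>(deriv ^^ j) (deriv f) x\<bar> \<le> C" for n j
    using assms unfolding schwartz_space_UNIV_iff funpow_deriv_Suc[symmetric] by blast
  then show ?thesis
    using assms smooth_deriv[of f] unfolding schwartz_space_UNIV_iff by blast
qed

lemma compact_support_schwartz_space: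
  assumes "smooth f" "\<And>x. r \<le> \<bar>x\<bar> \<Longrightarrow> f x = 0"
  shows "f \<in> schwartz_space UNIV"
proof -
  have "\<exists>C. \<forall>x. (1 + x\<^sup>2) ^ n * \<bar>(deriv ^^ j) f x\<bar> \<le> C" for n j
  proof -
    have "continuous_on UNIV (\<lambda>x::real. (1 + x\<^sup>2) ^ n)"
      by (intro continuous_intros)
    from compact_support_bound[OF assms this] show ?thesis .
  qed
  then show ?thesis
    using assms(1) by (simp add: schwartz_space_UNIV_iff)
qed

section \<open>Dilated cut-offs of Schwartz functions\<close>

lemma deriv_mult_dilation:
  assumes "smooth g" "smooth \<eta>"
  shows "((\<lambda>x. g x * \<eta> (t * x)) has_real_derivative
      deriv g x * \<eta> (t * x) + t * (g x * deriv \<eta> (t * x))) (at x)"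
proof -
  have "((\<lambda>x. t * x) has_real_derivative t) (at x)"
    by (auto intro!: derivative_eq_intros)
  from DERIV_mult[OF smooth_DERIV[OF assms(1)] DERIV_chain2[OF smooth_DERIV[OF assms(2)] this]]
  show ?thesis by (simp add: mult_ac)
qed

lemma smooth_mult_dilation:
  assumes "smooth g" "smooth \<eta>"
  shows "smooth (\<lambda>x. g x * \<eta> (t * x))"
  using smooth_mult[OF assms(1) smooth_scale[OF assms(2), of t 0]] by simp

text \<open>Differentiating once gives a product of the same shape with \<open>deriv g\<close>, plus
  \<open>t\<close> times one with \<open>deriv \<eta>\<close>. Hence the induction varies both
  functions, and \<open>t \<le> 1\<close> makes the bound uniform.\<close>

lemma dilated_cutoff_bound:
  assumes "g \<in> schwartz_space UNIV" "smooth \<eta>" "\<And>j. \<exists>B. \<forall>x. \<bar>(deriv ^^ j) \<eta> x\<bar> \<le> B"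
  shows "\<exists>C. \<forall>t\<in>{0..1}. \<forall>x. (1 + x\<^sup>2) ^ n * \<bar>(deriv ^^ j) (\<lambda>x. g x * \<eta> (t * x)) x\<bar> \<le> C"
  using assms
proof (induction j arbitrary: g \<eta>)
  case 0
  obtain C where C: "\<And>x. (1 + x\<^sup>2) ^ n * \<bar>g x\<bar> \<le> C"
    using 0(1)[unfolded schwartz_space_UNIV_iff, THEN conjunct2, rule_format, of n 0] by auto
  obtain B where B: "\<And>x. \<bar>\<eta> x\<bar> \<le> B"
    using 0(3)[of 0] by auto
  have "(1 + x\<^sup>2) ^ n * \<bar>g x * \<eta> (t * x)\<bar> \<le> C * B" for t x
  proof -
    have "((1 + x\<^sup>2) ^ n * \<bar>g x\<bar>) * \<bar>\<eta> (t * x)\<bar> \<le> C * B"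
      using C[of x] by (intro mult_mono C B) (auto intro: order_trans[rotated])
    then show ?thesis by (simp add: abs_mult mult.assoc)
  qed
  then show ?case by auto
next
  case (Suc j)
  have g: "smooth g" using Suc.prems(1) by (simp add: schwartz_space_UNIV_iff)
  have B: "\<exists>B. \<forall>x. \<bar>(deriv ^^ j) (deriv \<eta>) x\<bar> \<le> B" for j
    using Suc.prems(3)[of "Suc j"] unfolding funpow_deriv_Suc .
  obtain C1 where C1: "\<And>t x. t \<in> {0..1} \<Longrightarrow>
      (1 + x\<^sup>2) ^ n * \<bar>(deriv ^^ j) (\<lambda>x. deriv g x * \<eta> (t * x)) x\<bar> \<le> C1"
    using Suc.IH[OF schwartz_space_deriv[OF Suc.prems(1)] Suc.prems(2,3)] by blast
  obtain C2 where C2: "\<And>t x. t \<in> {0..1} \<Longrightarrow>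
      (1 + x\<^sup>2) ^ n * \<bar>(deriv ^^ j) (\<lambda>x. g x * deriv \<eta> (t * x)) x\<bar> \<le> C2"
    using Suc.IH[OF Suc.prems(1) smooth_deriv[OF Suc.prems(2)] B] by blast
  have "(1 + x\<^sup>2) ^ n * \<bar>(deriv ^^ Suc j) (\<lambda>x. g x * \<eta> (t * x)) x\<bar> \<le> C1 + C2"
    if t: "t \<in> {0..1}" for t x
  proof -
    let ?a = "(deriv ^^ j) (\<lambda>x. deriv g x * \<eta> (t * x)) x"
    let ?b = "(deriv ^^ j) (\<lambda>x. g x * deriv \<eta> (t * x)) x"
    have "deriv (\<lambda>x. g x * \<eta> (t * x)) = (\<lambda>x. deriv g x * \<eta> (t * x) + t * (g x * deriv \<eta> (t * x)))"
      using deriv_mult_dilation[OF g Suc.prems(2)] by (intro ext DERIV_imp_deriv)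
    then have eq: "(deriv ^^ Suc j) (\<lambda>x. g x * \<eta> (t * x)) x = ?a + t * ?b"
      unfolding funpow_deriv_Suc using g Suc.prems(2)
      by (simp add: funpow_deriv_add funpow_deriv_cmult smooth_mult smooth_const smooth_deriv
          smooth_mult_dilation)
    have "\<bar>?a + t * ?b\<bar> \<le> \<bar>?a\<bar> + \<bar>t * ?b\<bar>" by (rule abs_triangle_ineq)
    also have "\<bar>t * ?b\<bar> \<le> \<bar>?b\<bar>" using t by (auto simp: abs_mult intro: mult_left_le_one_le)
    finally have "\<bar>?a + t * ?b\<bar> \<le> \<bar>?a\<bar> + \<bar>?b\<bar>" by simp
    then have "(1 + x\<^sup>2) ^ n * \<bar>?a + t * ?b\<bar> \<le> (1 + x\<^sup>2) ^ n * (\<bar>?a\<bar> + \<bar>?b\<bar>)"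
      by (rule mult_left_mono) simp
    also have "\<dots> \<le> C1 + C2"
      using C1[OF t, of x] C2[OF t, of x] by (simp only: distrib_left)
    finally show ?thesis unfolding eq .
  qed
  then show ?case by blast
qed

text \<open>The rate \<open>t\<close> comes from the mean value theorem:
  \<open>\<eta> (t * x) - \<eta> 0\<close> is of size \<open>t * \<bar>x\<bar>\<close>, and
  \<open>\<bar>x\<bar> \<le> 1 + x\<^sup>2\<close> is absorbed by one more power of the weight on
  \<open>g\<close>. In the induction step the term with \<open>deriv \<eta>\<close> already carries
  the factor \<open>t\<close>, so boundedness is enough for it.\<close>

lemma dilated_cutoff_converges:
  assumes "g \<in> schwartz_space UNIV" "smooth \<eta>" "\<And>j. \<exists>B. \<forall>x. \<bar>(deriv ^^ j) \<eta> x\<bar> \<le> B"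
  shows "\<exists>C. \<forall>t\<in>{0..1}. \<forall>x.
    (1 + x\<^sup>2) ^ n * \<bar>(deriv ^^ j) (\<lambda>x. g x * \<eta> (t * x) - g x * \<eta> 0) x\<bar> \<le> C * t"
  using assms
proof (induction j arbitrary: g \<eta>)
  case 0
  obtain C where C: "\<And>x. (1 + x\<^sup>2) ^ Suc n * \<bar>g x\<bar> \<le> C"
    using 0(1)[unfolded schwartz_space_UNIV_iff, THEN conjunct2, rule_format, of "Suc n" 0]
    by (auto simp del: power_Suc)
  obtain B where B: "\<And>x. \<bar>deriv \<eta> x\<bar> \<le> B"
    using 0(3)[of 1] by auto
  have "(1 + x\<^sup>2) ^ n * \<bar>g x * \<eta> (t * x) - g x * \<eta> 0\<bar> \<le> (C * B) * t" if t: "t \<in> {0..1}" for t x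
  proof -
    have "0 \<le> B" using B[of 0] by linarith
    have "norm (\<eta> (t * x) - \<eta> 0) \<le> B * norm (t * x - 0)"
      by (rule field_differentiable_bound[of UNIV _ "deriv \<eta>"])
         (use B smooth_DERIV[OF 0(2)] in auto)
    then have "\<bar>\<eta> (t * x) - \<eta> 0\<bar> \<le> B * t * \<bar>x\<bar>"
      using t by (simp add: abs_mult)
    also have "\<dots> \<le> B * t * (1 + x\<^sup>2)"
    proof (rule mult_left_mono)
      have "0 \<le> (\<bar>x\<bar> - 1)\<^sup>2" by simp
      then show "\<bar>x\<bar> \<le> 1 + x\<^sup>2" by (simp add: power2_diff)
    qed (use t \<open>0 \<le> B\<close> in auto)
    finally have "(1 + x\<^sup>2) ^ n * \<bar>g x\<bar> * \<bar>\<eta> (t * x) - \<eta> 0\<bar> \<le>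
        (1 + x\<^sup>2) ^ n * \<bar>g x\<bar> * (B * t * (1 + x\<^sup>2))"
      by (rule mult_left_mono) simp
    also have "\<dots> = ((1 + x\<^sup>2) ^ Suc n * \<bar>g x\<bar>) * (B * t)" by simp
    also have "\<dots> \<le> C * (B * t)"
      by (rule mult_right_mono[OF C]) (use t \<open>0 \<le> B\<close> in auto)
    moreover have "\<bar>g x * \<eta> (t * x) - g x * \<eta> 0\<bar> = \<bar>g x\<bar> * \<bar>\<eta> (t * x) - \<eta> 0\<bar>"
      by (simp add: abs_mult flip: right_diff_distrib)
    ultimately show ?thesis by (simp add: mult_ac)
  qed
  then show ?case unfolding funpow_0 by blast
next
  case (Suc j)
  have g: "smooth g" using Suc.prems(1) by (simp add: schwartz_space_UNIV_iff)
  have B: "\<exists>B. \<forall>x. \<bar>(deriv ^^ j) (deriv \<eta>) x\<bar> \<le> B" for j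
    using Suc.prems(3)[of "Suc j"] unfolding funpow_deriv_Suc .
  obtain C1 where C1: "\<And>t x. t \<in> {0..1} \<Longrightarrow>
      (1 + x\<^sup>2) ^ n * \<bar>(deriv ^^ j) (\<lambda>x. deriv g x * \<eta> (t * x) - deriv g x * \<eta> 0) x\<bar> \<le> C1 * t"
    using Suc.IH[OF schwartz_space_deriv[OF Suc.prems(1)] Suc.prems(2,3)] by blast
  obtain C2 where C2: "\<And>t x. t \<in> {0..1} \<Longrightarrow>
      (1 + x\<^sup>2) ^ n * \<bar>(deriv ^^ j) (\<lambda>x. g x * deriv \<eta> (t * x)) x\<bar> \<le> C2"
    using dilated_cutoff_bound[OF Suc.prems(1) smooth_deriv[OF Suc.prems(2)] B] by blast
  have "(1 + x\<^sup>2) ^ n * \<bar>(deriv ^^ Suc j) (\<lambda>x. g x * \<eta> (t * x) - g x * \<eta> 0) x\<bar> \<le> (C1 + C2) * t"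
    if t: "t \<in> {0..1}" for t x
  proof -
    let ?a = "(deriv ^^ j) (\<lambda>x. deriv g x * \<eta> (t * x) - deriv g x * \<eta> 0) x"
    let ?b = "(deriv ^^ j) (\<lambda>x. g x * deriv \<eta> (t * x)) x"
    have "((\<lambda>x. g x * \<eta> (t * x) - g x * \<eta> 0) has_real_derivative
        (deriv g x * \<eta> (t * x) - deriv g x * \<eta> 0) + t * (g x * deriv \<eta> (t * x))) (at x)" for x
      using DERIV_diff[OF deriv_mult_dilation[OF g Suc.prems(2)]
          DERIV_cmult_right[OF smooth_DERIV[OF g], where c = "\<eta> 0"], of t x] by (simp add: algebra_simps)
    then have "deriv (\<lambda>x. g x * \<eta> (t * x) - g x * \<eta> 0) =
        (\<lambda>x. (deriv g x * \<eta> (t * x) - deriv g x * \<eta> 0) + t * (g x * deriv \<eta> (t * x)))"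
      by (intro ext DERIV_imp_deriv)
    then have eq: "(deriv ^^ Suc j) (\<lambda>x. g x * \<eta> (t * x) - g x * \<eta> 0) x = ?a + t * ?b"
      unfolding funpow_deriv_Suc using g Suc.prems(2)
      by (simp add: funpow_deriv_add funpow_deriv_cmult smooth_mult smooth_const smooth_deriv
          smooth_mult_dilation smooth_diff)
    have "\<bar>?a + t * ?b\<bar> \<le> \<bar>?a\<bar> + \<bar>t * ?b\<bar>" by (rule abs_triangle_ineq)
    also have "\<bar>t * ?b\<bar> = t * \<bar>?b\<bar>" using t by (simp add: abs_mult)
    finally have "(1 + x\<^sup>2) ^ n * \<bar>?a + t * ?b\<bar> \<le> (1 + x\<^sup>2) ^ n * (\<bar>?a\<bar> + t * \<bar>?b\<bar>)"
      by (rule mult_left_mono) simp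
    also have "\<dots> = (1 + x\<^sup>2) ^ n * \<bar>?a\<bar> + t * ((1 + x\<^sup>2) ^ n * \<bar>?b\<bar>)"
      by (simp add: algebra_simps)
    also have "\<dots> \<le> C1 * t + t * C2"
      using t by (intro add_mono C1 C2 mult_left_mono) auto
    finally show ?thesis unfolding eq by (simp add: algebra_simps)
  qed
  then show ?case by blast
qed

section \<open>Multipliers have polynomial growth\<close>

lemma bump_deriv_bounded: "\<exists>B. \<forall>x. \<bar>(deriv ^^ j) bump x\<bar> \<le> B"
  using compact_support_bound[of bump 1 "\<lambda>_. 1" j] by (simp add: smooth_bump bump_eq_0)

text \<open>The function is a sum of bumps centred at the points \<open>c k\<close>, of height
  \<open>1 / (1 + (c k)\<^sup>2) ^ k\<close>. Against a weight of exponent \<open>n\<close>, the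
  term \<open>k \<ge> n\<close> is of order \<open>(1 / 2) ^ (k - n)\<close>, because
  \<open>1 \<le> \<bar>c k\<bar>\<close> makes the base at least 2; so every weighted derivative
  series converges uniformly. The resulting function decays rapidly but is not too small at the
  given points.\<close>

lemma schwartz_space_bump_series:
  fixes c :: "nat \<Rightarrow> real"
  assumes c: "\<And>k. 1 \<le> \<bar>c k\<bar>"
  shows "\<exists>u \<in> schwartz_space UNIV. \<forall>k. 1 / (1 + (c k)\<^sup>2) ^ k \<le> u (c k)"
proof -
  define f where "f j k x = 1 / (1 + (c k)\<^sup>2) ^ k * (deriv ^^ j) bump (x - c k)" for j k x
  define G where "G j x = (\<Sum>k. f j k x)" for j x
  obtain B where B: "\<And>j x. \<bar>(deriv ^^ j) bump x\<bar> \<le> B j"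
    using bump_deriv_bounded by metis
  have B0: "0 \<le> B j" for j
    using B[of j 0] by linarith
  \<comment> \<open>The factor \<open>3 ^ n\<close> arises from
    \<open>1 + x\<^sup>2 \<le> 3 * (1 + (c k)\<^sup>2)\<close>, which holds within distance 1 of
    \<open>c k\<close>.\<close>
  define M where "M n j k = 3 ^ n * B j * ((1 + (c k)\<^sup>2) ^ n / (1 + (c k)\<^sup>2) ^ k)" for n j k
  have pos: "0 < 1 + (c k)\<^sup>2" for k
    by (simp add: add_pos_nonneg)
  have M: "(1 + x\<^sup>2) ^ n * \<bar>f j k x\<bar> \<le> M n j k" for n j k x
  proof (cases "1 < \<bar>x - c k\<bar>")
    case True
    then have "f j k x = 0"
      by (simp add: f_def funpow_deriv_eq_0_outside[OF bump_eq_0])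
    then show ?thesis using B0[of j] by (simp add: M_def)
  next
    case False
    then have "\<bar>x\<bar> \<le> \<bar>c k\<bar> + 1" by linarith
    then have "x\<^sup>2 \<le> (\<bar>c k\<bar> + 1)\<^sup>2"
      using power_mono[of "\<bar>x\<bar>" "\<bar>c k\<bar> + 1" 2] by simp
    moreover have "0 \<le> (\<bar>c k\<bar> - 1)\<^sup>2" by simp
    ultimately have "1 + x\<^sup>2 \<le> 3 * (1 + (c k)\<^sup>2)"
      using zero_le_power2[of "c k"] unfolding power2_sum power2_diff power2_abs one_power2 mult_1_right distrib_left by linarith
    then have "(1 + x\<^sup>2) ^ n \<le> 3 ^ n * (1 + (c k)\<^sup>2) ^ n"
      unfolding power_mult_distrib[symmetric] by (rule power_mono) simp
    moreover have "\<bar>f j k x\<bar> \<le> B j / (1 + (c k)\<^sup>2) ^ k"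
      using B[of j "x - c k"] pos[of k] by (simp add: f_def abs_mult divide_right_mono)
    ultimately have "(1 + x\<^sup>2) ^ n * \<bar>f j k x\<bar> \<le>
        (3 ^ n * (1 + (c k)\<^sup>2) ^ n) * (B j / (1 + (c k)\<^sup>2) ^ k)"
      by (intro mult_mono) auto
    then show ?thesis by (simp add: M_def mult_ac)
  qed
  have summable_M: "summable (M n j)" for n j
  proof (rule summable_comparison_test')
    show "summable (\<lambda>k. 3 ^ n * B j * 2 ^ n * (1 / 2) ^ k)"
      by (intro summable_mult summable_geometric) simp
    fix k assume "n \<le> k"
    then obtain d where k: "k = n + d" using le_Suc_ex by blast
    have "(2::real) \<le> 1 + (c k)\<^sup>2"
      using power_mono[OF c[of k], of 2] by simp
    then have "2 ^ d \<le> (1 + (c k)\<^sup>2) ^ d"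
      by (intro power_mono) auto
    then have "1 / (1 + (c k)\<^sup>2) ^ d \<le> 1 / 2 ^ d"
      by (intro divide_left_mono) (use pos[of k] in auto)
    also have "1 / 2 ^ d = 2 ^ n * (1 / 2 :: real) ^ k"
      by (simp add: k power_add power_one_over)
    finally have "1 / (1 + (c k)\<^sup>2) ^ d \<le> 2 ^ n * (1 / 2) ^ k" .
    moreover have "(1 + (c k)\<^sup>2) ^ n / (1 + (c k)\<^sup>2) ^ k = 1 / (1 + (c k)\<^sup>2) ^ d"
      using pos[of k] by (simp add: k power_add)
    ultimately have "M n j k \<le> 3 ^ n * B j * (2 ^ n * (1 / 2) ^ k)"
      unfolding M_def using B0[of j] by (intro mult_left_mono) auto
    moreover have "0 \<le> M n j k"
      using B0[of j] by (simp add: M_def)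
    ultimately show "norm (M n j k) \<le> 3 ^ n * B j * 2 ^ n * (1 / 2) ^ k"
      by (simp add: mult_ac)
  qed
  have f_le: "norm (f j k x) \<le> M 0 j k" for j k x
    using M[of x 0 j k] by simp
  have summable_f: "summable (\<lambda>k. \<bar>f j k x\<bar>)" for j x
    by (rule summable_comparison_test'[OF summable_M[of 0 j], of 0]) (use f_le in auto)
  have deriv_f: "(f j k has_real_derivative f (Suc j) k x) (at x)" for j k x
  proof -
    have "((\<lambda>x. x - c k) has_real_derivative 1) (at x)"
      by (auto intro!: derivative_eq_intros)
    from DERIV_cmult[OF DERIV_chain2[OF smooth_has_derivative[OF smooth_bump, of j] this],
        where c = "1 / (1 + (c k)\<^sup>2) ^ k"]
    show ?thesis by (simp add: f_def[abs_def])
  qed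
  \<comment> \<open>Termwise differentiation, with uniform convergence of the differentiated series
    from the Weierstrass test and the majorants for weight exponent 0.\<close>
  have deriv_G: "(G j has_real_derivative G (Suc j) x) (at x)" for j x
    unfolding G_def[abs_def]
  proof (rule has_field_derivative_series'(2)[where S = UNIV])
    show "uniformly_convergent_on UNIV (\<lambda>n x. \<Sum>i<n. f (Suc j) i x)"
      by (rule Weierstrass_m_test'[OF f_le summable_M])
    show "summable (\<lambda>k. f j k 0)"
      by (rule summable_rabs_cancel[OF summable_f])
  qed (auto simp: deriv_f)
  have bound: "(1 + x\<^sup>2) ^ n * \<bar>G j x\<bar> \<le> suminf (M n j)" for n j x
  proof -
    have "\<bar>G j x\<bar> \<le> (\<Sum>k. \<bar>f j k x\<bar>)"
      unfolding G_def by (rule summable_rabs[OF summable_f])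
    then have "(1 + x\<^sup>2) ^ n * \<bar>G j x\<bar> \<le> (1 + x\<^sup>2) ^ n * (\<Sum>k. \<bar>f j k x\<bar>)"
      by (rule mult_left_mono) simp
    also have "\<dots> = (\<Sum>k. (1 + x\<^sup>2) ^ n * \<bar>f j k x\<bar>)"
      by (rule suminf_mult[symmetric, OF summable_f])
    also have "\<dots> \<le> suminf (M n j)"
      by (intro suminf_le M summable_M summable_mult summable_f)
    finally show ?thesis .
  qed
  have "smooth (G 0)" and eq: "\<And>j. (deriv ^^ j) (G 0) = G j"
    using smoothI[of G, OF deriv_G] funpow_deriv_eqI[of G, OF deriv_G] by blast+
  then have "G 0 \<in> schwartz_space UNIV"
    unfolding schwartz_space_UNIV_iff eq using bound by blast
  moreover have "1 / (1 + (c k)\<^sup>2) ^ k \<le> G 0 (c k)" for k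
  proof -
    \<comment> \<open>The terms are nonnegative, so the sum dominates its term of index
      \<open>k\<close> even where bumps overlap.\<close>
    have "(\<Sum>i\<in>{k}. f 0 i (c k)) \<le> (\<Sum>i. f 0 i (c k))"
      by (rule sum_le_suminf[OF summable_rabs_cancel[OF summable_f]])
         (auto simp: f_def bump_nonneg)
    then show ?thesis by (simp add: G_def f_def bump_0)
  qed
  ultimately show ?thesis by blast
qed

text \<open>If \<open>m\<close> outgrew all polynomials, there would be points \<open>c k\<close>
  with \<open>\<bar>m (c k)\<bar>\<close> above \<open>k * (1 + (c k)\<^sup>2) ^ k\<close>.
  Multiplying by the bump series for these points gives values of modulus at least \<open>k\<close>,
  hence an unbounded product.\<close>

lemma multiplier_polynomial_growth:
  assumes I: "closed_unbounded_interval I"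
    and m: "multiplication_operator I m \<in> schwartz_space I \<rightarrow> schwartz_space I"
    and cont: "continuous_on UNIV m"
  shows "\<exists>C N. \<forall>x\<in>I. \<bar>m x\<bar> \<le> C * (1 + x\<^sup>2) ^ N"
proof (rule ccontr)
  assume "\<not> ?thesis"
  then have large: "\<exists>x\<in>I. C * (1 + x\<^sup>2) ^ N < \<bar>m x\<bar>" for C N
    by (meson not_le)
  \<comment> \<open>A point where \<open>\<bar>m x\<bar>\<close> exceeds \<open>B\<close> lies
    outside the interval from -1 to 1, as the bump series requires of its centres.\<close>
  have "compact (m ` {-1..1})"
    by (intro compact_continuous_image continuous_on_subset[OF cont]) auto
  then obtain B where B: "\<forall>x\<in>{-1..1}. \<bar>m x\<bar> \<le> B"
    by (auto dest!: compact_imp_bounded simp: bounded_iff simp del: atLeastAtMost_iff)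
  have "\<exists>x. x \<in> I \<and> 1 \<le> \<bar>x\<bar> \<and> real k * (1 + x\<^sup>2) ^ k < \<bar>m x\<bar>" for k
  proof -
    obtain x where x: "x \<in> I" "max (real k) B * (1 + x\<^sup>2) ^ k < \<bar>m x\<bar>"
      using large by blast
    have one: "1 \<le> (1 + x\<^sup>2) ^ k" by (rule one_le_power) simp
    have "real k * (1 + x\<^sup>2) ^ k \<le> max (real k) B * (1 + x\<^sup>2) ^ k"
      by (rule mult_right_mono) auto
    moreover have "max (real k) B * 1 \<le> max (real k) B * (1 + x\<^sup>2) ^ k"
      by (rule mult_left_mono[OF one]) auto
    then have "B < \<bar>m x\<bar>" using x(2) by linarith
    then have "x \<notin> {-1..1}" using B by force
    then have "1 \<le> \<bar>x\<bar>" by auto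
    ultimately show ?thesis using x by (intro exI[of _ x]) auto
  qed
  then have "\<exists>c. \<forall>k. c k \<in> I \<and> 1 \<le> \<bar>c k\<bar> \<and> real k * (1 + (c k)\<^sup>2) ^ k < \<bar>m (c k)\<bar>"
    by (intro choice allI)
  then obtain c where c: "\<And>k. c k \<in> I" "\<And>k. 1 \<le> \<bar>c k\<bar>"
    "\<And>k. real k * (1 + (c k)\<^sup>2) ^ k < \<bar>m (c k)\<bar>"
    by blast
  obtain u where u: "u \<in> schwartz_space UNIV" "\<And>k. 1 / (1 + (c k)\<^sup>2) ^ k \<le> u (c k)"
    using schwartz_space_bump_series[of c, OF c(2)] by blast
  have "multiplication_operator I m (restrict u I) \<in> schwartz_space I"
    using m restrict_schwartz_space[OF u(1) I] by blast
  then obtain C where "\<forall>x\<in>I. (1 + x\<^sup>2) ^ 0 *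
      \<bar>nth_deriv_within I 0 (multiplication_operator I m (restrict u I)) x\<bar> \<le> C"
    unfolding schwartz_space_iff by blast
  then have C: "\<forall>x\<in>I. \<bar>multiplication_operator I m (restrict u I) x\<bar> \<le> C"
    by simp
  obtain k where k: "C < real k"
    using reals_Archimedean2 by blast
  have pos: "0 < (1 + (c k)\<^sup>2) ^ k"
    by (simp add: add_pos_nonneg)
  have "real k = (real k * (1 + (c k)\<^sup>2) ^ k) * (1 / (1 + (c k)\<^sup>2) ^ k)"
    using pos by (simp del: power_eq_0_iff)
  also have "\<dots> \<le> \<bar>m (c k)\<bar> * \<bar>u (c k)\<bar>"
    using c(3)[of k] u(2)[of k] pos by (intro mult_mono) auto
  also have "\<dots> \<le> C"
    using C[rule_format, OF c(1)[of k]] c(1)[of k] by (simp add: multiplication_operator_def abs_mult)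
  finally show False using k by simp
qed

section \<open>Seminorm topologies\<close>

text \<open>Outside \<open>I\<close> the difference has the value 0 and not
  \<open>undefined\<close>, so it need not belong to \<open>smooth_functions I\<close>. Therefore
  differences are handled through the values of their derivatives at points of
  \<open>I\<close>.\<close>

lemma nth_deriv_within_diff:
  assumes I: "closed_unbounded_interval I"
    and f: "f \<in> smooth_functions I" and g: "g \<in> smooth_functions I" and "x \<in> I"
  shows "nth_deriv_within I n (\<lambda>x. f x - g x) x = nth_deriv_within I n f x - nth_deriv_within I n g x"
  using \<open>x \<in> I\<close>
proof (induction n arbitrary: x)
  case (Suc n)
  have d: "(nth_deriv_within I n h has_vector_derivative nth_deriv_within I (Suc n) h x) (at x within I)"
    if "h \<in> smooth_functions I" for h
    using that Suc.prems
    by (auto simp: smooth_functions_def differentiable_on_def simp flip: vector_derivative_works)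
  have "((\<lambda>x. nth_deriv_within I n f x - nth_deriv_within I n g x) has_vector_derivative
      nth_deriv_within I (Suc n) f x - nth_deriv_within I (Suc n) g x) (at x within I)"
    by (intro has_vector_derivative_diff d f g)
  then have "(nth_deriv_within I n (\<lambda>x. f x - g x) has_vector_derivative
      nth_deriv_within I (Suc n) f x - nth_deriv_within I (Suc n) g x) (at x within I)"
    by (rule has_vector_derivative_transform[OF Suc.prems, rotated]) (simp add: Suc.IH)
  then show ?case
    using at_within_closed_unbounded_interval[OF I Suc.prems]
    by (simp add: vector_derivative_within)
qed simp

lemma schwartz_seminorm_le:
  assumes "closed_unbounded_interval I"
    "\<And>x j. x \<in> I \<Longrightarrow> j \<le> n \<Longrightarrow> (1 + x\<^sup>2) ^ n * \<bar>nth_deriv_within I j f x\<bar> \<le> C"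
  shows "schwartz_seminorm I n f \<le> C"
proof -
  have "I \<noteq> {}"
    using assms(1) by (auto simp: closed_unbounded_interval_def)
  then show ?thesis
    unfolding schwartz_seminorm_def
    by (intro cSUP_least) (auto simp: schwartz_weight_def assms(2))
qed

text \<open>A real supremum is an upper bound only once the set is known to be bounded above; the
  sum of bounds for \<open>f\<close> and \<open>g\<close> provides this.\<close>

lemma le_schwartz_seminorm_diff:
  assumes I: "closed_unbounded_interval I"
    and f: "f \<in> schwartz_space I" and g: "g \<in> schwartz_space I"
    and x: "x \<in> I" "j \<le> n"
  shows "(1 + x\<^sup>2) ^ n * \<bar>nth_deriv_within I j f x - nth_deriv_within I j g x\<bar>
    \<le> schwartz_seminorm I n (\<lambda>x. f x - g x)"
proof -
  let ?h = "\<lambda>x. f x - g x"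
  have fg: "f \<in> smooth_functions I" "g \<in> smooth_functions I"
    using f g by (auto simp: schwartz_space_def)
  obtain A where A: "\<forall>y\<in>schwartz_weight I n f ` (I \<times> {0..n}). y \<le> A"
    using f unfolding schwartz_space_def bdd_above_def by blast
  obtain B where B: "\<forall>y\<in>schwartz_weight I n g ` (I \<times> {0..n}). y \<le> B"
    using g unfolding schwartz_space_def bdd_above_def by blast
  have weight: "schwartz_weight I n ?h (y, i) =
      (1 + y\<^sup>2) ^ n * \<bar>nth_deriv_within I i f y - nth_deriv_within I i g y\<bar>" if "y \<in> I" for y i
    by (simp add: schwartz_weight_def nth_deriv_within_diff[OF I fg that])
  have "schwartz_weight I n ?h (y, i) \<le> A + B" if y: "y \<in> I" "i \<le> n" for y i
  proof -
    have "schwartz_weight I n ?h (y, i) \<le>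
        (1 + y\<^sup>2) ^ n * (\<bar>nth_deriv_within I i f y\<bar> + \<bar>nth_deriv_within I i g y\<bar>)"
      unfolding weight[OF y(1)] by (intro mult_left_mono abs_triangle_ineq4) simp
    also have "\<dots> = schwartz_weight I n f (y, i) + schwartz_weight I n g (y, i)"
      by (simp add: schwartz_weight_def distrib_left)
    also have "\<dots> \<le> A + B"
      using A B y by (intro add_mono) auto
    finally show ?thesis .
  qed
  then have "bdd_above (schwartz_weight I n ?h ` (I \<times> {0..n}))"
    by (intro bdd_aboveI[of _ "A + B"]) auto
  from cSUP_upper[OF _ this, of "(x, j)"] x show ?thesis
    by (simp add: schwartz_seminorm_def weight)
qed

lemma schwartz_seminorm_triangle:
  assumes I: "closed_unbounded_interval I"
    and f: "f \<in> schwartz_space I" and g: "g \<in> schwartz_space I" and h: "h \<in> schwartz_space I"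
  shows "schwartz_seminorm I n (\<lambda>x. f x - h x) \<le>
    schwartz_seminorm I n (\<lambda>x. f x - g x) + schwartz_seminorm I n (\<lambda>x. g x - h x)"
proof (rule schwartz_seminorm_le[OF I])
  fix x j assume x: "x \<in> I" "j \<le> n"
  let ?d = "\<lambda>f. nth_deriv_within I j f x"
  have fh: "f \<in> smooth_functions I" "h \<in> smooth_functions I"
    using f h by (auto simp: schwartz_space_def)
  have "\<bar>?d f - ?d h\<bar> \<le> \<bar>?d f - ?d g\<bar> + \<bar>?d g - ?d h\<bar>" by linarith
  then have "(1 + x\<^sup>2) ^ n * \<bar>?d f - ?d h\<bar> \<le>
      (1 + x\<^sup>2) ^ n * (\<bar>?d f - ?d g\<bar> + \<bar>?d g - ?d h\<bar>)"
    by (rule mult_left_mono) simp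
  also have "\<dots> \<le> schwartz_seminorm I n (\<lambda>x. f x - g x) + schwartz_seminorm I n (\<lambda>x. g x - h x)"
    unfolding distrib_left by (intro add_mono le_schwartz_seminorm_diff I f g h x)
  finally show "(1 + x\<^sup>2) ^ n * \<bar>?d (\<lambda>x. f x - h x)\<bar> \<le> \<dots>"
    by (simp add: nth_deriv_within_diff[OF I fh x(1)])
qed

text \<open>Induction on the generation of open sets. In a subbasic ball around \<open>f\<close> the
  point \<open>v\<close> has positive distance to the boundary value \<open>e\<close>, and the
  triangle inequality keeps \<open>w k\<close> in the ball once it is closer to \<open>v\<close>
  than that.\<close>

lemma eventually_in_schwartz_open:
  assumes I: "closed_unbounded_interval I" and U: "openin (schwartz_topology I) U" and "v \<in> U"
    and w: "\<And>k. w k \<in> schwartz_space I"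
    and lim: "\<And>n. (\<lambda>k. schwartz_seminorm I n (\<lambda>x. w k x - v x)) \<longlonglongrightarrow> 0"
  shows "\<forall>\<^sub>F k in sequentially. w k \<in> U"
proof -
  have "generate_topology_on {{g \<in> schwartz_space I. p (\<lambda>x. g x - f x) < e} |p f e.
      p \<in> range (schwartz_seminorm I) \<and> f \<in> schwartz_space I \<and> 0 < e} U"
    using U unfolding schwartz_topology_def seminorm_topology_def
    by (rule openin_topology_generated_by)
  then show ?thesis
    using \<open>v \<in> U\<close>
  proof induction
    case (Int A B)
    then show ?case by (auto intro: eventually_conj)
  next
    case (UN K)
    then obtain A where "A \<in> K" "\<forall>\<^sub>F k in sequentially. w k \<in> A" by blast
    then show ?case by (auto elim: eventually_mono)
  next
    case (Basis S)
    then obtain n f e where S: "S = {g \<in> schwartz_space I. schwartz_seminorm I n (\<lambda>x. g x - f x) < e}"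
      and f: "f \<in> schwartz_space I" by blast
    then have v: "v \<in> schwartz_space I" "0 < e - schwartz_seminorm I n (\<lambda>x. v x - f x)"
      using Basis by auto
    from order_tendstoD(2)[OF lim v(2)] show ?case
    proof (rule eventually_mono)
      fix k assume "schwartz_seminorm I n (\<lambda>x. w k x - v x) < e - schwartz_seminorm I n (\<lambda>x. v x - f x)"
      then show "w k \<in> S"
        using schwartz_seminorm_triangle[OF I w[of k] v(1) f, of n] w[of k] by (simp add: S)
    qed
  qed simp
qed

lemma schwartz_closedin_limit:
  assumes I: "closed_unbounded_interval I" and R: "closedin (schwartz_topology I) R"
    and w: "\<And>k. w k \<in> R" and v: "v \<in> schwartz_space I"
    and lim: "\<And>n. (\<lambda>k. schwartz_seminorm I n (\<lambda>x. w k x - v x)) \<longlonglongrightarrow> 0"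
  shows "v \<in> R"
proof (rule ccontr)
  assume "v \<notin> R"
  have top: "topspace (schwartz_topology I) = schwartz_space I"
    by (rule topspace_schwartz_topology[OF I])
  have "openin (schwartz_topology I) (schwartz_space I - R)" "R \<subseteq> schwartz_space I"
    using R unfolding closedin_def top by auto
  with eventually_in_schwartz_open[OF I this(1) _ _ lim] w v \<open>v \<notin> R\<close>
  have "\<forall>\<^sub>F k in sequentially. w k \<in> schwartz_space I - R" by blast
  then show False using w by simp
qed

section \<open>Continuity of the inclusion of Schwartz functions into smooth functions\<close>

lemma schwartz_space_subset_smooth: "schwartz_space I \<subseteq> smooth_functions I"
  by (auto simp: schwartz_space_def)

text \<open>The weight is at least 1, so the Schwartz seminorm of index \<open>n\<close> dominates
  the derivative of order \<open>n\<close>. The centre \<open>f\<close> of a ball of smooth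
  functions need not be a Schwartz function, whence the detour through \<open>h\<close>.\<close>

lemma smooth_seminorm_le_schwartz_seminorm:
  assumes K: "compact K" "K \<noteq> {}" and f: "f \<in> smooth_functions UNIV"
    and gh: "g \<in> schwartz_space UNIV" "h \<in> schwartz_space UNIV"
  shows "smooth_seminorm K n (\<lambda>x. g x - f x) \<le>
    schwartz_seminorm UNIV n (\<lambda>x. g x - h x) + smooth_seminorm K n (\<lambda>x. h x - f x)"
proof -
  let ?d = "nth_deriv_within UNIV n"
  have gh': "g \<in> smooth_functions UNIV" "h \<in> smooth_functions UNIV"
    using gh schwartz_space_subset_smooth by auto
  note diff = nth_deriv_within_diff[OF closed_unbounded_interval_UNIV _ _ UNIV_I]
  have cont: "continuous_on K (?d u)" if "u \<in> smooth_functions UNIV" for u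
    using that smooth_continuous_on by (simp add: nth_deriv_within_UNIV smooth_functions_UNIV)
  have "compact ((\<lambda>x. \<bar>?d h x - ?d f x\<bar>) ` K)"
    by (intro compact_continuous_image continuous_on_rabs continuous_on_diff cont f gh' K)
  then have bdd: "bdd_above ((\<lambda>x. \<bar>?d h x - ?d f x\<bar>) ` K)"
    by (intro bounded_imp_bdd_above compact_imp_bounded)
  show ?thesis
    unfolding smooth_seminorm_def diff[OF gh'(1) f] diff[OF gh'(2) f]
  proof (rule cSUP_least[OF K(2)])
    fix x assume x: "x \<in> K"
    have "\<bar>?d g x - ?d h x\<bar> \<le> (1 + x\<^sup>2) ^ n * \<bar>?d g x - ?d h x\<bar>"
      using mult_right_mono[OF one_le_power[of "1 + x\<^sup>2" n], of "\<bar>?d g x - ?d h x\<bar>"] by simp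
    also have "\<dots> \<le> schwartz_seminorm UNIV n (\<lambda>x. g x - h x)"
      by (rule le_schwartz_seminorm_diff[OF closed_unbounded_interval_UNIV gh]) auto
    finally have "\<bar>?d g x - ?d h x\<bar> \<le> schwartz_seminorm UNIV n (\<lambda>x. g x - h x)" .
    moreover have "\<bar>?d h x - ?d f x\<bar> \<le> (SUP x\<in>K. \<bar>?d h x - ?d f x\<bar>)"
      by (rule cSUP_upper[OF x bdd])
    ultimately show "\<bar>?d g x - ?d f x\<bar> \<le>
        schwartz_seminorm UNIV n (\<lambda>x. g x - h x) + (SUP x\<in>K. \<bar>?d h x - ?d f x\<bar>)"
      by linarith
  qed
qed

lemma schwartz_seminorm_zero: "schwartz_seminorm UNIV n (\<lambda>x. 0) = 0"
  by (simp add: schwartz_seminorm_def schwartz_weight_def nth_deriv_within_zero cong: SUP_cong_simp)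

lemma openin_schwartz_ball:
  assumes "g \<in> schwartz_space UNIV" "0 < e"
  shows "openin (schwartz_topology UNIV)
    {h \<in> schwartz_space UNIV. schwartz_seminorm UNIV n (\<lambda>x. h x - g x) < e}"
  unfolding schwartz_topology_def seminorm_topology_def openin_topology_generated_by_iff
  by (rule generate_topology_on.Basis) (use assms in blast)

text \<open>Checked on subbasic sets: around each Schwartz function \<open>g\<close> in a ball of
  smooth functions, the Schwartz ball of radius \<open>d\<close>, the slack left at
  \<open>g\<close>, stays inside.\<close>

lemma openin_smooth_imp_openin_schwartz:
  assumes "openin smooth_topology U"
  shows "openin (schwartz_topology UNIV) (U \<inter> schwartz_space UNIV)"
proof -
  have "generate_topology_on {{g \<in> smooth_functions UNIV. p (\<lambda>x. g x - f x) < e} |p f e.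
      p \<in> {smooth_seminorm K n |K n. compact K \<and> K \<noteq> {}} \<and> f \<in> smooth_functions UNIV \<and> 0 < e} U"
    using assms unfolding smooth_topology_def seminorm_topology_def
    by (rule openin_topology_generated_by)
  then show ?thesis
  proof induction
    case (Int A B)
    from openin_Int[OF Int.IH] show ?case by (simp add: Int_ac Int_left_absorb)
  next
    case (UN k)
    have "\<Union> k \<inter> schwartz_space UNIV = (\<Union>A\<in>k. A \<inter> schwartz_space UNIV)" by blast
    then show ?case using UN.IH by (simp only:) (intro openin_Union, blast)
  next
    case (Basis S)
    then obtain K n f e where
      S: "S = {g \<in> smooth_functions UNIV. smooth_seminorm K n (\<lambda>x. g x - f x) < e}"
      and K: "compact K" "K \<noteq> {}" and f: "f \<in> smooth_functions UNIV" by blast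
    show ?case
    proof (subst openin_subopen, intro ballI)
      fix g assume g: "g \<in> S \<inter> schwartz_space UNIV"
      define d where "d = e - smooth_seminorm K n (\<lambda>x. g x - f x)"
      have "0 < d" using g by (simp add: S d_def)
      let ?T = "{h \<in> schwartz_space UNIV. schwartz_seminorm UNIV n (\<lambda>x. h x - g x) < d}"
      have "openin (schwartz_topology UNIV) ?T"
        using g \<open>0 < d\<close> by (intro openin_schwartz_ball) auto
      moreover have "g \<in> ?T"
        using g \<open>0 < d\<close> by (simp add: schwartz_seminorm_zero)
      moreover have "?T \<subseteq> S \<inter> schwartz_space UNIV"
        using smooth_seminorm_le_schwartz_seminorm[OF K f, of _ g n] g schwartz_space_subset_smooth
        by (fastforce simp: S d_def)
      ultimately show "\<exists>T. openin (schwartz_topology UNIV) T \<and> g \<in> T \<and> T \<subseteq> S \<inter> schwartz_space UNIV"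
        by blast
    qed
  qed simp
qed

lemma closedin_smooth_imp_closedin_schwartz:
  assumes "closedin smooth_topology R"
  shows "closedin (schwartz_topology UNIV) (R \<inter> schwartz_space UNIV)"
proof -
  have top: "topspace (schwartz_topology UNIV) = schwartz_space UNIV"
    by (rule topspace_schwartz_topology[OF closed_unbounded_interval_UNIV])
  have "openin smooth_topology (smooth_functions UNIV - R)"
    using assms by (simp add: closedin_def topspace_smooth_topology)
  from openin_smooth_imp_openin_schwartz[OF this]
  have "openin (schwartz_topology UNIV) ((smooth_functions UNIV - R) \<inter> schwartz_space UNIV)" .
  also have "(smooth_functions UNIV - R) \<inter> schwartz_space UNIV =
      schwartz_space UNIV - R \<inter> schwartz_space UNIV"
    using schwartz_space_subset_smooth by auto
  finally show ?thesis by (simp add: closedin_def top)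
qed

section \<open>Rays on which the symbol may be locally constant\<close>

lemma abs_le_1_plus_square: "\<bar>x\<bar> \<le> 1 + x\<^sup>2" for x :: real
proof -
  have "0 \<le> (\<bar>x\<bar> - 1)\<^sup>2" by simp
  then show ?thesis by (simp add: power2_diff)
qed

text \<open>
  Where \<open>\<phi>\<close> is constant, the bound is inherited from the next point \<open>b\<close> at which \<open>\<phi>\<close> varies: the
  value of \<open>w \<circ> \<phi>\<close> is the same there and the weight is larger.
\<close>

lemma right_ray_bound:
  assumes \<phi>: "smooth \<phi>" and w: "smooth w" and R: "0 \<le> R"
    and nonconst: "\<And>x. \<exists>t\<ge>x. deriv \<phi> t \<noteq> 0"
    and bound: "\<And>t. R < t \<Longrightarrow> deriv \<phi> t \<noteq> 0 \<Longrightarrow>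
      (1 + t\<^sup>2) ^ n * \<bar>(deriv ^^ j) (\<lambda>x. w (\<phi> x)) t\<bar> \<le> C"
    and x: "R < x"
  shows "(1 + x\<^sup>2) ^ n * \<bar>(deriv ^^ j) (\<lambda>x. w (\<phi> x)) x\<bar> \<le> C"
proof -
  let ?u = "\<lambda>x. w (\<phi> x)"
  define S where "S = {t. x \<le> t \<and> deriv \<phi> t \<noteq> 0}"
  define b where "b = Inf S"
  have cont: "continuous_on A ((deriv ^^ j) ?u)" for A
    by (rule smooth_continuous_on[OF smooth_compose[OF w \<phi>]])
  have S: "S \<noteq> {}" "bdd_below S"
    using nonconst[of x] by (auto simp: S_def)
  have "x \<le> b"
    unfolding b_def by (rule cInf_greatest[OF S(1)]) (simp add: S_def)
  have zero: "deriv \<phi> t = 0" if "x \<le> t" "t < b" for t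
    using cInf_lower[OF _ S(2), of t] that by (auto simp: b_def S_def)
  \<comment> \<open>The derivative of \<open>\<phi>\<close> may vanish at \<open>b\<close> itself,
    but \<open>b\<close> lies in the closure of \<open>S\<close> and the estimate is a closed
    condition.\<close>
  let ?E = "{t. (1 + t\<^sup>2) ^ n * \<bar>(deriv ^^ j) ?u t\<bar> \<le> C}"
  have "closed ?E"
    by (intro closed_Collect_le continuous_on_mult continuous_on_rabs cont continuous_intros)
  moreover have "S \<subseteq> ?E"
    using bound x by (auto simp: S_def)
  ultimately have "closure S \<subseteq> ?E"
    by (rule closure_minimal[rotated])
  then have b: "(1 + b\<^sup>2) ^ n * \<bar>(deriv ^^ j) ?u b\<bar> \<le> C"
    using closure_contains_Inf[OF S] by (auto simp: b_def)
  show ?thesis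
  proof (cases "x = b")
    case True
    then show ?thesis using b by simp
  next
    case False
    then have "x < b" using \<open>x \<le> b\<close> by simp
    have const: "\<phi> t = \<phi> x" if "x \<le> t" "t \<le> b" for t
    proof (rule DERIV_isconst2[OF \<open>x < b\<close> _ _ that])
      show "continuous_on {x..b} \<phi>"
        using smooth_continuous_on[OF \<phi>, of _ 0] by simp
      show "(\<phi> has_real_derivative 0) (at y)" if "x < y" "y < b" for y
        using smooth_DERIV[OF \<phi>, of y] zero[of y] that by simp
    qed
    show ?thesis
    proof (cases j)
      case 0
      have "(1 + x\<^sup>2) ^ n \<le> (1 + b\<^sup>2) ^ n"
        using R x \<open>x \<le> b\<close> by (intro power_mono add_left_mono) auto
      then have "(1 + x\<^sup>2) ^ n * \<bar>?u b\<bar> \<le> (1 + b\<^sup>2) ^ n * \<bar>?u b\<bar>"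
        by (rule mult_right_mono) simp
      also have "(1 + b\<^sup>2) ^ n * \<bar>?u b\<bar> \<le> C"
        using b by (simp add: 0)
      also have "\<phi> b = \<phi> x"
        by (rule const[OF \<open>x \<le> b\<close> order_refl])
      finally show ?thesis
        unfolding 0 funpow_0 .
    next
      case (Suc i)
      \<comment> \<open>On the open interval from \<open>x\<close> to \<open>b\<close> the
        composition is constant, so its derivative of positive order vanishes there, and by
        continuity at \<open>x\<close> too.\<close>
      have "(deriv ^^ j) ?u t = 0" if "t \<in> {x<..<b}" for t
      proof -
        have "(deriv ^^ j) ?u t = (deriv ^^ j) (\<lambda>_. ?u x) t"
        proof (rule funpow_deriv_cong_open[of "{x<..<b}"])
          fix y assume "y \<in> {x<..<b}"
          then have "\<phi> y = \<phi> x" by (intro const) auto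
          then show "?u y = ?u x" by simp
        qed (use that in auto)
        then show ?thesis by (simp add: Suc funpow_deriv_const del: funpow.simps)
      qed
      then have "{x<..<b} \<subseteq> {t. (deriv ^^ j) ?u t = 0}" by blast
      moreover have "closed {t. (deriv ^^ j) ?u t = 0}"
        by (intro closed_Collect_eq cont continuous_on_const)
      ultimately have "closure {x<..<b} \<subseteq> {t. (deriv ^^ j) ?u t = 0}"
        by (rule closure_minimal)
      moreover have "x \<in> closure {x<..<b}"
        using \<open>x < b\<close> by simp
      ultimately have "(deriv ^^ j) ?u x = 0" by blast
      moreover have "0 \<le> C"
        by (rule order_trans[OF _ b]) simp
      ultimately show ?thesis by simp
    qed
  qed
qed

text \<open>Reduced to the right ray by the reflection of the line at 0: derivatives change at most
  in sign and the weight is even.\<close>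

lemma left_ray_bound:
  assumes \<phi>: "smooth \<phi>" and w: "smooth w" and R: "0 \<le> R"
    and nonconst: "\<And>x. \<exists>t\<le>x. deriv \<phi> t \<noteq> 0"
    and bound: "\<And>t. t < - R \<Longrightarrow> deriv \<phi> t \<noteq> 0 \<Longrightarrow>
      (1 + t\<^sup>2) ^ n * \<bar>(deriv ^^ j) (\<lambda>x. w (\<phi> x)) t\<bar> \<le> C"
    and x: "x < - R"
  shows "(1 + x\<^sup>2) ^ n * \<bar>(deriv ^^ j) (\<lambda>x. w (\<phi> x)) x\<bar> \<le> C"
proof -
  let ?\<psi> = "\<lambda>x. \<phi> (- 1 * x + 0)"
  have \<psi>: "smooth ?\<psi>" by (rule smooth_scale[OF \<phi>])
  have d: "deriv ?\<psi> t = - deriv \<phi> (- t)" for t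
    using funpow_deriv_scale[OF \<phi>, of 1 "- 1" 0 t] by simp
  have D: "\<bar>(deriv ^^ j) (\<lambda>x. w (?\<psi> x)) t\<bar> = \<bar>(deriv ^^ j) (\<lambda>x. w (\<phi> x)) (- t)\<bar>" for t
    using funpow_deriv_scale[OF smooth_compose[OF w \<phi>], of j "- 1" 0 t]
    by (simp add: abs_mult power_abs)
  have "\<exists>t\<ge>y. deriv ?\<psi> t \<noteq> 0" for y
  proof -
    obtain t where "t \<le> - y" "deriv \<phi> t \<noteq> 0" using nonconst by blast
    then show ?thesis unfolding d by (intro exI[of _ "- t"]) auto
  qed
  moreover have "(1 + t\<^sup>2) ^ n * \<bar>(deriv ^^ j) (\<lambda>x. w (?\<psi> x)) t\<bar> \<le> C"
    if "R < t" "deriv ?\<psi> t \<noteq> 0" for t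
    using bound[of "- t"] that unfolding D d by simp
  moreover have "R < - x" using x by simp
  ultimately have "(1 + (- x)\<^sup>2) ^ n * \<bar>(deriv ^^ j) (\<lambda>x. w (?\<psi> x)) (- x)\<bar> \<le> C"
    by (rule right_ray_bound[OF \<psi> w R])
  then show ?thesis unfolding D by simp
qed

text \<open>Otherwise \<open>\<phi>\<close> has a constant value \<open>c\<close> on
  \<open>J\<close>. Composing a bump centred at \<open>c\<close> with \<open>\<phi>\<close> gives 1
  on the unbounded set \<open>J\<close>, which contradicts decay.\<close>

lemma schwartz_symbol_nonconstant:
  assumes \<phi>: "schwartz_symbol \<phi>" and J: "is_interval J" "\<not> bounded J"
  shows "\<exists>t\<in>J. deriv \<phi> t \<noteq> 0"
proof (rule ccontr)
  assume "\<not> ?thesis"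
  then have zero: "\<And>t. t \<in> J \<Longrightarrow> deriv \<phi> t = 0" by blast
  have s: "smooth \<phi>" using \<phi> by (simp add: schwartz_symbol_def smooth_functions_UNIV)
  have "convex J" using J(1) by (simp add: is_interval_convex)
  moreover have "(\<phi> has_real_derivative 0) (at t within J)" if "t \<in> J" for t
    using smooth_DERIV[OF s, of t] zero[OF that] by (simp add: has_field_derivative_at_within)
  ultimately obtain c where c: "\<And>t. t \<in> J \<Longrightarrow> \<phi> t = c"
    using has_field_derivative_zero_constant[of J \<phi>] by blast
  let ?f = "\<lambda>y. bump (1 * y + (- c))"
  have "?f \<in> schwartz_space UNIV"
  proof (rule compact_support_schwartz_space)
    show "smooth ?f" by (rule smooth_scale[OF smooth_bump])
    show "?f y = 0" if "\<bar>c\<bar> + 1 \<le> \<bar>y\<bar>" for y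
      by (rule bump_eq_0) (use that in linarith)
  qed
  then have "?f \<circ> \<phi> \<in> schwartz_space UNIV"
    using \<phi> unfolding schwartz_symbol_def by blast
  then obtain C where C: "\<And>x. (1 + x\<^sup>2) ^ 1 * \<bar>(deriv ^^ 0) (?f \<circ> \<phi>) x\<bar> \<le> C"
    unfolding schwartz_space_UNIV_iff by blast
  have "\<bar>t\<bar> \<le> C" if "t \<in> J" for t
    using C[of t] c[OF that] abs_le_1_plus_square[of t] by (simp add: bump_0)
  then show False using J(2) by (auto simp: bounded_iff)
qed

section \<open>Differentiating a factorization\<close>

text \<open>Although \<open>deriv F \<circ> \<phi>\<close> is not yet known to decay, its products
  with dilated bumps have compact support and so restrict to elements of the domain. Their images
  tend to the restriction of \<open>g\<close>, because \<open>g\<close> is a Schwartz function and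
  \<open>bump 0 = 1\<close>. Closedness of the range yields a preimage \<open>h\<close>, which can
  be identified by division where \<open>deriv \<phi>\<close> is nonzero.\<close>

lemma multiplier_factorization:
  assumes I: "closed_unbounded_interval I"
    and closed: "closedin (schwartz_topology I) (multiplication_operator I (deriv \<phi>) ` schwartz_space I)"
    and \<phi>: "smooth \<phi>" and F: "smooth F" and S: "(\<lambda>x. F (\<phi> x)) \<in> schwartz_space UNIV"
  shows "\<exists>h\<in>schwartz_space I. \<forall>x\<in>I. deriv \<phi> x \<noteq> 0 \<longrightarrow> h x = deriv F (\<phi> x)"
proof -
  let ?M = "multiplication_operator I (deriv \<phi>)"
  let ?u = "\<lambda>x. deriv F (\<phi> x)"
  define g where "g = deriv (\<lambda>x. F (\<phi> x))"
  \<comment> \<open>With this dilation the cut-off vanishes for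
    \<open>\<bar>x\<bar> \<ge> k + 1\<close>; the successor avoids division by 0.\<close>
  define t where "t k = inverse (real (Suc k))" for k
  define w where "w k = ?M (restrict (\<lambda>x. ?u x * bump (t k * x)) I)" for k
  have t: "t k \<in> {0..1}" "0 < t k" for k
    by (auto simp: t_def inverse_le_1_iff)
  have u: "smooth ?u" by (rule smooth_compose[OF smooth_deriv[OF F] \<phi>])
  have g: "g \<in> schwartz_space UNIV" unfolding g_def by (rule schwartz_space_deriv[OF S])
  then have smooth_g: "smooth g" by (simp add: schwartz_space_UNIV_iff)
  have g_eq: "g x = deriv \<phi> x * ?u x" for x
    using DERIV_imp_deriv[OF DERIV_chain2[OF smooth_DERIV[OF F] smooth_DERIV[OF \<phi>]]]
    by (simp add: g_def mult.commute)
  have w_range: "w k \<in> ?M ` schwartz_space I" for k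
    unfolding w_def
  proof (intro imageI restrict_schwartz_space[OF _ I] compact_support_schwartz_space)
    show "smooth (\<lambda>x. ?u x * bump (t k * x))"
      by (rule smooth_mult_dilation[OF u smooth_bump])
    show "?u x * bump (t k * x) = 0" if "real (Suc k) \<le> \<bar>x\<bar>" for x
    proof -
      have "t k * real (Suc k) \<le> t k * \<bar>x\<bar>"
        using that t(2)[of k] by (intro mult_left_mono) auto
      then have "1 \<le> \<bar>t k * x\<bar>"
        using t(2)[of k] by (simp add: abs_mult t_def del: of_nat_Suc)
      then show ?thesis by (simp add: bump_eq_0)
    qed
  qed
  have "?M ` schwartz_space I \<subseteq> schwartz_space I"
    using closedin_subset[OF closed] topspace_schwartz_topology[OF I] by simp
  then have w_S: "w k \<in> schwartz_space I" for k using w_range by blast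
  have gI: "restrict g I \<in> schwartz_space I" by (rule restrict_schwartz_space[OF g I])
  have diff: "w k x - restrict g I x = g x * bump (t k * x) - g x * bump 0" if "x \<in> I" for k x
    using that by (simp add: w_def multiplication_operator_def g_eq bump_0 algebra_simps)
  have "(\<lambda>k. schwartz_seminorm I n (\<lambda>x. w k x - restrict g I x)) \<longlonglongrightarrow> 0" for n
  proof -
    have "\<exists>C. \<forall>j. \<forall>s\<in>{0..1}. \<forall>x. (1 + x\<^sup>2) ^ n *
        \<bar>(deriv ^^ j) (\<lambda>x. g x * bump (s * x) - g x * bump 0) x\<bar> \<le> C j * s"
      by (intro choice allI dilated_cutoff_converges[OF g smooth_bump bump_deriv_bounded])
    then obtain C where C: "\<And>j s x. s \<in> {0..1} \<Longrightarrow> (1 + x\<^sup>2) ^ n *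
        \<bar>(deriv ^^ j) (\<lambda>x. g x * bump (s * x) - g x * bump 0) x\<bar> \<le> C j * s" by blast
    define K where "K = (\<Sum>j\<le>n. \<bar>C j\<bar>)"
    have upper: "schwartz_seminorm I n (\<lambda>x. w k x - restrict g I x) \<le> K * t k" for k
    proof (rule schwartz_seminorm_le[OF I])
      fix x j assume x: "x \<in> I" "j \<le> n"
      have "smooth (\<lambda>x. g x * bump (t k * x) - g x * bump 0)"
        by (rule smooth_diff[OF smooth_mult_dilation[OF smooth_g smooth_bump]
              smooth_mult[OF smooth_g smooth_const]])
      from nth_deriv_within_eq_interval[OF this I diff x(1)]
      have "(1 + x\<^sup>2) ^ n * \<bar>nth_deriv_within I j (\<lambda>x. w k x - restrict g I x) x\<bar> \<le> C j * t k"
        using C[OF t(1)] by simp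
      also have "\<dots> \<le> K * t k"
      proof (rule mult_right_mono)
        have "C j \<le> \<bar>C j\<bar>" by simp
        also have "\<dots> \<le> K" unfolding K_def using x(2) by (intro member_le_sum) auto
        finally show "C j \<le> K" .
      qed (use t in auto)
      finally show "(1 + x\<^sup>2) ^ n * \<bar>nth_deriv_within I j (\<lambda>x. w k x - restrict g I x) x\<bar> \<le> K * t k" .
    qed
    have lower: "0 \<le> schwartz_seminorm I n (\<lambda>x. w k x - restrict g I x)" for k
    proof -
      have "I \<noteq> {}" using I by (auto simp: closed_unbounded_interval_def)
      then obtain x where "x \<in> I" by blast
      from le_schwartz_seminorm_diff[OF I w_S gI this, of 0 n k] show ?thesis
        by (rule order_trans[rotated]) auto
    qed
    have "(\<lambda>k. K * t k) \<longlonglongrightarrow> K * 0"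
      unfolding t_def by (intro tendsto_mult tendsto_const LIMSEQ_inverse_real_of_nat)
    then have lim: "(\<lambda>k. K * t k) \<longlonglongrightarrow> 0" by simp
    show ?thesis
      by (rule tendsto_sandwich[OF _ _ tendsto_const lim]) (use lower upper in auto)
  qed
  from schwartz_closedin_limit[OF I closed w_range gI this]
  obtain h where h: "h \<in> schwartz_space I" "restrict g I = ?M h" by blast
  have "h x = ?u x" if "x \<in> I" "deriv \<phi> x \<noteq> 0" for x
    using fun_cong[OF h(2), of x] that by (simp add: multiplication_operator_def g_eq)
  then show ?thesis using h(1) by blast
qed

text \<open>On the open set of points of \<open>W\<close> where \<open>deriv \<phi>\<close> is
  nonzero, \<open>h\<close> agrees with \<open>deriv F \<circ> \<phi>\<close>, hence so do all
  derivatives, and the bounds for \<open>h\<close> carry over.\<close>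

lemma multiplier_factorization_bound:
  assumes I: "closed_unbounded_interval I"
    and closed: "closedin (schwartz_topology I) (multiplication_operator I (deriv \<phi>) ` schwartz_space I)"
    and \<phi>: "smooth \<phi>" and F: "smooth F" and S: "(\<lambda>x. F (\<phi> x)) \<in> schwartz_space UNIV"
    and W: "open W" "W \<subseteq> I"
  shows "\<exists>C. \<forall>x\<in>W. deriv \<phi> x \<noteq> 0 \<longrightarrow> (1 + x\<^sup>2) ^ n * \<bar>(deriv ^^ j) (\<lambda>x. deriv F (\<phi> x)) x\<bar> \<le> C"
proof -
  obtain h where h: "h \<in> schwartz_space I" "\<forall>x\<in>I. deriv \<phi> x \<noteq> 0 \<longrightarrow> h x = deriv F (\<phi> x)"
    using multiplier_factorization[OF I closed \<phi> F S] by blast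
  then obtain C where C: "\<forall>x\<in>I. (1 + x\<^sup>2) ^ n * \<bar>nth_deriv_within I j h x\<bar> \<le> C"
    unfolding schwartz_space_iff by blast
  let ?V = "W \<inter> {x. deriv \<phi> x \<noteq> 0}"
  have "continuous_on UNIV (deriv \<phi>)"
    using smooth_continuous_on[OF \<phi>, of _ 1] by simp
  then have "open {x. deriv \<phi> x \<noteq> 0}"
    by (intro open_Collect_neq continuous_on_const)
  then have "open ?V" using W(1) by blast
  have "smooth (\<lambda>x. deriv F (\<phi> x))" by (rule smooth_compose[OF smooth_deriv[OF F] \<phi>])
  from nth_deriv_within_eq_open[OF this \<open>open ?V\<close>, of I h _ j] W(2) h(2)
  have eq: "nth_deriv_within I j h x = (deriv ^^ j) (\<lambda>x. deriv F (\<phi> x)) x" if "x \<in> ?V" for x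
    using that by blast
  have "(1 + x\<^sup>2) ^ n * \<bar>(deriv ^^ j) (\<lambda>x. deriv F (\<phi> x)) x\<bar> \<le> C" if "x \<in> ?V" for x
    using C W(2) that eq[OF that] by (metis IntD1 subsetD)
  then show ?thesis by blast
qed

section \<open>Rays contained in the two intervals\<close>

lemma unbounded_interval_contains_ray:
  fixes I1 I2 :: "real set"
  assumes "is_interval I1" "is_interval I2" and cover: "\<And>x. B < x \<Longrightarrow> x \<in> I1 \<union> I2"
  shows "\<exists>I\<in>{I1, I2}. \<exists>R\<ge>0. {R<..} \<subseteq> I"
proof -
  have "\<exists>I\<in>{I1, I2}. \<forall>M. \<exists>z\<in>I. M < z"
  proof (rule ccontr)
    assume "\<not> ?thesis"
    then obtain M1 M2 where M: "\<And>z. z \<in> I1 \<Longrightarrow> z \<le> M1" "\<And>z. z \<in> I2 \<Longrightarrow> z \<le> M2"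
      by (auto simp: not_less)
    define z where "z = max B (max M1 M2) + 1"
    have "B < z" "M1 < z" "M2 < z" unfolding z_def by linarith+
    then show False using cover[of z] M(1)[of z] M(2)[of z] by auto
  qed
  then obtain I where I: "I \<in> {I1, I2}" "\<And>M. \<exists>z\<in>I. M < z" by blast
  then have int: "is_interval I" using assms by auto
  obtain y where y: "y \<in> I" using I(2) by blast
  \<comment> \<open>An interval unbounded above contains everything to the right of each of its
    points; the maximum with 0 only makes the endpoint nonnegative.\<close>
  have "{max 0 y<..} \<subseteq> I"
  proof
    fix x assume "x \<in> {max 0 y<..}"
    then have "y \<le> x" by simp
    moreover obtain z where z: "z \<in> I" "x < z" using I(2) by blast
    ultimately show "x \<in> I"
      using mem_is_interval_1_I[OF int y z(1)] by simp
  qed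
  then show ?thesis using I(1) by (intro bexI[of _ I] exI[of _ "max 0 y"]) auto
qed

text \<open>The left ray is found by reflecting both intervals. The same interval may serve for both
  rays.\<close>

lemma cobounded_intervals_contain_rays:
  fixes I1 I2 :: "real set"
  assumes "is_interval I1" "is_interval I2" and "bounded (UNIV - (I1 \<union> I2))"
  obtains R I J where "0 \<le> R" "I \<in> {I1, I2}" "J \<in> {I1, I2}" "{R<..} \<subseteq> I" "{..<- R} \<subseteq> J"
proof -
  obtain B where B: "\<And>x. x \<notin> I1 \<union> I2 \<Longrightarrow> \<bar>x\<bar> \<le> B"
    using assms(3) by (auto simp: bounded_iff)
  have right: "x \<in> I1 \<union> I2" if "B < x" for x
    using B[of x] that by fastforce
  have left: "x \<in> uminus ` I1 \<union> uminus ` I2" if "B < x" for x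
  proof -
    have "- x \<in> I1 \<union> I2" using B[of "- x"] that by fastforce
    then show ?thesis using image_eqI[of x uminus "- x"] by auto
  qed
  obtain I R where I: "I \<in> {I1, I2}" "0 \<le> R" "{R<..} \<subseteq> I"
    using unbounded_interval_contains_ray[of I1 I2 B, OF assms(1,2) right] by blast
  have "is_interval (uminus ` I1)" "is_interval (uminus ` I2)"
    using assms(1,2) by simp_all
  then obtain J' R' where J': "J' \<in> {uminus ` I1, uminus ` I2}" "{R'<..} \<subseteq> J'"
    using unbounded_interval_contains_ray[of "uminus ` I1" "uminus ` I2" B] left by blast
  then obtain J where J: "J \<in> {I1, I2}" "J' = uminus ` J" by blast
  have "{max R R'<..} \<subseteq> I" using I(3) by auto
  moreover have "{..<- max R R'} \<subseteq> J"
  proof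
    fix x assume "x \<in> {..<- max R R'}"
    then have "- x \<in> J'" using J'(2) by auto
    then show "x \<in> J" by (auto simp: J(2))
  qed
  moreover have "0 \<le> max R R'" using I(2) by auto
  ultimately show thesis using that I(1) J(1) by blast
qed

text \<open>The line is split into two rays and a compact middle part. On the rays the factorization
  controls the points where \<open>deriv \<phi>\<close> is nonzero, and the ray lemmas extend the
  bound over the zeros; in the middle continuity suffices.\<close>

lemma schwartz_derivative_factor:
  assumes \<phi>: "schwartz_symbol \<phi>"
    and intervals: "closed_unbounded_interval I1" "closed_unbounded_interval I2"
      "bounded (UNIV - (I1 \<union> I2))"
    and closed: "\<And>I. I \<in> {I1, I2} \<Longrightarrow>
      closedin (schwartz_topology I) (multiplication_operator I (deriv \<phi>) ` schwartz_space I)"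
    and F: "smooth F" and S: "(\<lambda>x. F (\<phi> x)) \<in> schwartz_space UNIV"
  shows "(\<lambda>x. deriv F (\<phi> x)) \<in> schwartz_space UNIV"
proof -
  let ?u = "\<lambda>x. deriv F (\<phi> x)"
  have \<phi>': "smooth \<phi>" using \<phi> by (simp add: schwartz_symbol_def smooth_functions_UNIV)
  have w: "smooth (deriv F)" by (rule smooth_deriv[OF F])
  have u: "smooth ?u" by (rule smooth_compose[OF w \<phi>'])
  have "is_interval I1" "is_interval I2"
    using intervals by (auto simp: closed_unbounded_interval_def)
  then obtain R I J where R: "0 \<le> R" "I \<in> {I1, I2}" "J \<in> {I1, I2}" "{R<..} \<subseteq> I" "{..<- R} \<subseteq> J"
    using intervals(3) by (rule cobounded_intervals_contain_rays)
  have IJ: "closed_unbounded_interval I" "closed_unbounded_interval J"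
    using R(2,3) intervals by auto
  have unbounded: "\<not> bounded {x..}" "\<not> bounded {..x}" for x :: real
  proof -
    have "\<exists>y\<ge>x. a < \<bar>y\<bar>" "\<exists>y\<le>x. a < \<bar>y\<bar>" for a
      by (rule exI[of _ "\<bar>x\<bar> + \<bar>a\<bar> + 1"], linarith)
         (rule exI[of _ "- \<bar>x\<bar> - \<bar>a\<bar> - 1"], linarith)
    then show "\<not> bounded {x..}" "\<not> bounded {..x}"
      by (auto simp: bounded_iff not_le)
  qed
  \<comment> \<open>The ray lemmas need points with nonzero \<open>deriv \<phi>\<close> arbitrarily
    far out on both sides.\<close>
  have right: "\<exists>t\<ge>x. deriv \<phi> t \<noteq> 0" and left: "\<exists>t\<le>x. deriv \<phi> t \<noteq> 0" for x
    using schwartz_symbol_nonconstant[OF \<phi> _ unbounded(1)[of x]]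
      schwartz_symbol_nonconstant[OF \<phi> _ unbounded(2)[of x]]
    by (auto simp: is_interval_ci is_interval_ic)
  have "\<exists>C. \<forall>x. (1 + x\<^sup>2) ^ n * \<bar>(deriv ^^ j) ?u x\<bar> \<le> C" for n j
  proof -
    let ?b = "\<lambda>x. (1 + x\<^sup>2) ^ n * \<bar>(deriv ^^ j) ?u x\<bar>"
    obtain C1 where C1: "\<forall>x\<in>{R<..}. deriv \<phi> x \<noteq> 0 \<longrightarrow> ?b x \<le> C1"
      using multiplier_factorization_bound[OF IJ(1) closed[OF R(2)] \<phi>' F S open_greaterThan R(4)] by blast
    obtain C2 where C2: "\<forall>x\<in>{..<- R}. deriv \<phi> x \<noteq> 0 \<longrightarrow> ?b x \<le> C2"
      using multiplier_factorization_bound[OF IJ(2) closed[OF R(3)] \<phi>' F S open_lessThan R(5)] by blast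
    have "continuous_on {- R..R} ?b"
      by (intro continuous_on_mult continuous_on_rabs smooth_continuous_on[OF u] continuous_intros)
    then have "compact (?b ` {- R..R})"
      by (rule compact_continuous_image) simp
    then obtain C3 where C3: "\<forall>x\<in>{- R..R}. \<bar>?b x\<bar> \<le> C3"
      by (auto dest!: compact_imp_bounded simp: bounded_iff simp del: atLeastAtMost_iff)
    have "?b x \<le> max C1 (max C2 C3)" for x
    proof -
      consider "R < x" | "x < - R" | "x \<in> {- R..R}" by fastforce
      then show ?thesis
      proof cases
        case 1
        have "?b x \<le> C1"
          by (rule right_ray_bound[OF \<phi>' w R(1) right _ 1]) (use C1 in auto)
        then show ?thesis by simp
      next
        case 2
        have "?b x \<le> C2"
          by (rule left_ray_bound[OF \<phi>' w R(1) left _ 2]) (use C2 in auto)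
        then show ?thesis by simp
      next
        case 3
        then have "\<bar>?b x\<bar> \<le> C3" using C3 by blast
        then show ?thesis by linarith
      qed
    qed
    then show ?thesis by blast
  qed
  then show ?thesis using u by (simp only: schwartz_space_UNIV_iff) blast
qed

section \<open>Polynomial growth of the symbol and decay of the outer function\<close>

lemma polynomial_growth_of_deriv:
  assumes f: "smooth f" and f': "\<And>x. \<bar>deriv f x\<bar> \<le> C * (1 + x\<^sup>2) ^ N"
  shows "\<exists>K\<ge>0. \<forall>x. \<bar>f x\<bar> \<le> K * (1 + x\<^sup>2) ^ Suc N"
proof -
  have C: "0 \<le> C" using order_trans[OF abs_ge_zero f'[of 0]] by simp
  have "\<bar>f x\<bar> \<le> (\<bar>f 0\<bar> + C) * (1 + x\<^sup>2) ^ Suc N" for x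
  proof -
    \<comment> \<open>Mean value estimate on the symmetric interval of radius
      \<open>\<bar>x\<bar>\<close>, where the bound on the derivative is largest at the ends; the
      factor \<open>\<bar>x\<bar>\<close> then costs one more power of the weight.\<close>
    have "norm (f x - f 0) \<le> (C * (1 + x\<^sup>2) ^ N) * norm (x - 0)"
    proof (rule field_differentiable_bound[of "{- \<bar>x\<bar>..\<bar>x\<bar>}" f "deriv f"])
      fix y assume "y \<in> {- \<bar>x\<bar>..\<bar>x\<bar>}"
      then have "\<bar>y\<bar> \<le> \<bar>x\<bar>" by auto
      then have "y\<^sup>2 \<le> x\<^sup>2" by (simp add: abs_le_square_iff)
      then have "(1 + y\<^sup>2) ^ N \<le> (1 + x\<^sup>2) ^ N" by (intro power_mono) auto
      then have "C * (1 + y\<^sup>2) ^ N \<le> C * (1 + x\<^sup>2) ^ N" by (rule mult_left_mono[OF _ C])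
      with f'[of y] show "norm (deriv f y) \<le> C * (1 + x\<^sup>2) ^ N" by simp
      show "(f has_field_derivative deriv f y) (at y within {- \<bar>x\<bar>..\<bar>x\<bar>})"
        by (rule has_field_derivative_at_within[OF smooth_DERIV[OF f]])
    qed auto
    also have "\<dots> \<le> (C * (1 + x\<^sup>2) ^ N) * (1 + x\<^sup>2)"
      using C by (intro mult_left_mono) (simp_all add: abs_le_1_plus_square)
    finally have "\<bar>f x - f 0\<bar> \<le> C * (1 + x\<^sup>2) ^ Suc N" by (simp add: mult_ac)
    moreover have "\<bar>f 0\<bar> * 1 \<le> \<bar>f 0\<bar> * (1 + x\<^sup>2) ^ Suc N"
      by (intro mult_left_mono one_le_power) auto
    ultimately have "\<bar>f x\<bar> \<le> \<bar>f 0\<bar> * (1 + x\<^sup>2) ^ Suc N + C * (1 + x\<^sup>2) ^ Suc N"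
      by linarith
    then show ?thesis by (simp only: distrib_right)
  qed
  then show ?thesis using C by (intro exI[of _ "\<bar>f 0\<bar> + C"]) auto
qed

lemma symbol_polynomial_growth:
  assumes \<phi>: "smooth \<phi>"
    and intervals: "closed_unbounded_interval I1" "closed_unbounded_interval I2"
      "bounded (UNIV - (I1 \<union> I2))"
    and mult: "\<And>I. I \<in> {I1, I2} \<Longrightarrow>
      multiplication_operator I (deriv \<phi>) \<in> schwartz_space I \<rightarrow> schwartz_space I"
  shows "\<exists>K N. 0 \<le> K \<and> (\<forall>x. \<bar>\<phi> x\<bar> \<le> K * (1 + x\<^sup>2) ^ N)"
proof -
  have cont: "continuous_on A (deriv \<phi>)" for A
    using smooth_continuous_on[OF \<phi>, of _ 1] by simp
  obtain C1 N1 where b1: "\<forall>x\<in>I1. \<bar>deriv \<phi> x\<bar> \<le> C1 * (1 + x\<^sup>2) ^ N1"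
    using multiplier_polynomial_growth[OF intervals(1) mult cont] by blast
  obtain C2 N2 where b2: "\<forall>x\<in>I2. \<bar>deriv \<phi> x\<bar> \<le> C2 * (1 + x\<^sup>2) ^ N2"
    using multiplier_polynomial_growth[OF intervals(2) mult cont] by blast
  obtain r where r': "\<forall>x\<in>UNIV - (I1 \<union> I2). \<bar>x\<bar> \<le> r"
    using intervals(3) unfolding bounded_iff real_norm_def by blast
  have r: "x \<in> {- r..r}" if "x \<notin> I1 \<union> I2" for x
    using r'[rule_format, of x] that by auto
  have "compact (deriv \<phi> ` {- r..r})"
    by (intro compact_continuous_image cont) simp
  then obtain C3 where b3: "\<forall>x\<in>{- r..r}. \<bar>deriv \<phi> x\<bar> \<le> C3"
    by (auto dest!: compact_imp_bounded simp: bounded_iff simp del: atLeastAtMost_iff)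
  \<comment> \<open>The absolute values make \<open>C\<close> nonnegative and an upper bound of all
    three constants, whatever their signs.\<close>
  define C where "C = \<bar>C1\<bar> + \<bar>C2\<bar> + \<bar>C3\<bar>"
  have le: "c * (1 + x\<^sup>2) ^ m \<le> C * (1 + x\<^sup>2) ^ (N1 + N2)" if "c \<le> C" "m \<le> N1 + N2" for c x m
    using that by (intro mult_mono power_increasing) (auto simp: C_def)
  have "\<bar>deriv \<phi> x\<bar> \<le> C * (1 + x\<^sup>2) ^ (N1 + N2)" for x
  proof -
    consider "x \<in> I1" | "x \<in> I2" | "x \<in> {- r..r}" using r[of x] by blast
    then show ?thesis
    proof cases
      case 1
      then show ?thesis
        by (intro order_trans[OF b1[rule_format]] le) (auto simp: C_def)
    next
      case 2
      then show ?thesis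
        by (intro order_trans[OF b2[rule_format]] le) (auto simp: C_def)
    next
      case 3
      then show ?thesis
        using order_trans[OF b3[rule_format], of x] le[of C3 0 x] by (auto simp: C_def)
    qed
  qed
  from polynomial_growth_of_deriv[OF \<phi> this] show ?thesis by blast
qed

text \<open>Every \<open>y\<close> is some \<open>\<phi> x\<close>, and then \<open>1 + y\<^sup>2
  \<le> (1 + K\<^sup>2) * (1 + x\<^sup>2) ^ (2 * N)\<close>. So weight exponent \<open>n\<close> at
  \<open>y\<close> is paid for by exponent \<open>2 * N * n\<close> at \<open>x\<close>.\<close>

lemma schwartz_space_outer_factor:
  assumes surj: "surj \<phi>" and K: "0 \<le> K" "\<And>x. \<bar>\<phi> x\<bar> \<le> K * (1 + x\<^sup>2) ^ N"
    and F: "smooth F" and S: "\<And>j. (\<lambda>x. (deriv ^^ j) F (\<phi> x)) \<in> schwartz_space UNIV"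
  shows "F \<in> schwartz_space UNIV"
proof -
  have "\<exists>C. \<forall>y. (1 + y\<^sup>2) ^ n * \<bar>(deriv ^^ j) F y\<bar> \<le> C" for n j
  proof -
    obtain C where C: "\<And>x. (1 + x\<^sup>2) ^ (2 * N * n) * \<bar>(deriv ^^ 0) (\<lambda>x. (deriv ^^ j) F (\<phi> x)) x\<bar> \<le> C"
      using S[of j] unfolding schwartz_space_UNIV_iff by blast
    have "(1 + y\<^sup>2) ^ n * \<bar>(deriv ^^ j) F y\<bar> \<le> (1 + K\<^sup>2) ^ n * C" for y
    proof -
      obtain x where y: "y = \<phi> x" using surj by (metis surjD)
      let ?q = "(1 + x\<^sup>2) ^ (2 * N)"
      have "y\<^sup>2 \<le> (K * (1 + x\<^sup>2) ^ N)\<^sup>2"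
        using K(2)[of x] power_mono[of "\<bar>y\<bar>" _ 2] by (simp add: y)
      also have "\<dots> = K\<^sup>2 * ?q"
        by (simp add: power_mult_distrib mult.commute flip: power_mult)
      finally have "y\<^sup>2 \<le> K\<^sup>2 * ?q" .
      moreover have "1 \<le> ?q" by (rule one_le_power) simp
      ultimately have "1 + y\<^sup>2 \<le> (1 + K\<^sup>2) * ?q"
        unfolding distrib_right by linarith
      then have "(1 + y\<^sup>2) ^ n \<le> ((1 + K\<^sup>2) * ?q) ^ n"
        by (rule power_mono) simp
      also have "\<dots> = (1 + K\<^sup>2) ^ n * (1 + x\<^sup>2) ^ (2 * N * n)"
        by (simp only: power_mult_distrib flip: power_mult)
      finally have "(1 + y\<^sup>2) ^ n * \<bar>(deriv ^^ j) F y\<bar> \<le>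
          ((1 + K\<^sup>2) ^ n * (1 + x\<^sup>2) ^ (2 * N * n)) * \<bar>(deriv ^^ j) F y\<bar>"
        by (rule mult_right_mono) simp
      also have "\<dots> = (1 + K\<^sup>2) ^ n * ((1 + x\<^sup>2) ^ (2 * N * n) * \<bar>(deriv ^^ j) F y\<bar>)"
        by (simp only: mult.assoc)
      also have "\<dots> \<le> (1 + K\<^sup>2) ^ n * C"
        using C[of x] by (intro mult_left_mono) (simp_all add: y)
      finally show ?thesis .
    qed
    then show ?thesis by blast
  qed
  then show ?thesis using F by (simp only: schwartz_space_UNIV_iff) blast
qed

theorem theorem4p7:
  fixes \<phi> :: "real \<Rightarrow> real"
  assumes "schwartz_symbol \<phi>"
    and "surj \<phi>"
    and "closedin smooth_topology (composition_operator \<phi> ` smooth_functions UNIV)"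
    and "\<exists>I\<^sub>1 I\<^sub>2. closed_unbounded_interval I\<^sub>1 \<and> closed_unbounded_interval I\<^sub>2 \<and>
           bounded (UNIV - (I\<^sub>1 \<union> I\<^sub>2)) \<and>
           (\<forall>I \<in> {I\<^sub>1, I\<^sub>2}.
              multiplication_operator I (deriv \<phi>) \<in> schwartz_space I \<rightarrow> schwartz_space I \<and>
              closedin (schwartz_topology I)
                (multiplication_operator I (deriv \<phi>) ` schwartz_space I))"
  shows "closedin (schwartz_topology UNIV) (composition_operator \<phi> ` schwartz_space UNIV)"
proof -
  obtain I1 I2 where I: "closed_unbounded_interval I1" "closed_unbounded_interval I2"
      "bounded (UNIV - (I1 \<union> I2))"
    and M: "\<And>I. I \<in> {I1, I2} \<Longrightarrow>
      multiplication_operator I (deriv \<phi>) \<in> schwartz_space I \<rightarrow> schwartz_space I"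
      "\<And>I. I \<in> {I1, I2} \<Longrightarrow>
      closedin (schwartz_topology I) (multiplication_operator I (deriv \<phi>) ` schwartz_space I)"
    using assms(4) by blast
  have \<phi>: "smooth \<phi>"
    using assms(1) by (simp add: schwartz_symbol_def smooth_functions_UNIV)
  obtain K N where K: "0 \<le> K" "\<And>x. \<bar>\<phi> x\<bar> \<le> K * (1 + x\<^sup>2) ^ N"
    using symbol_polynomial_growth[OF \<phi> I M(1)] by blast
  have "F \<in> schwartz_space UNIV"
    if F: "smooth F" and S: "(\<lambda>x. F (\<phi> x)) \<in> schwartz_space UNIV" for F
  proof (rule schwartz_space_outer_factor[OF assms(2) K F])
    show "(\<lambda>x. (deriv ^^ j) F (\<phi> x)) \<in> schwartz_space UNIV" for j
    \<comment> \<open>Each step applies the derivative lemma to the smooth outer function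
      \<open>(deriv ^^ j) F\<close>, whose composition with \<open>\<phi>\<close> is a Schwartz
      function by the induction hypothesis.\<close>
    proof (induction j)
      case (Suc j)
      from schwartz_derivative_factor[OF assms(1) I M(2) smooth_funpow_deriv[OF F] Suc.IH]
      show ?case by simp
    qed (simp add: S)
  qed
  \<comment> \<open>The range on Schwartz functions is thus the trace of the closed range on smooth
    functions.\<close>
  then have "composition_operator \<phi> ` smooth_functions UNIV \<inter> schwartz_space UNIV \<subseteq>
      composition_operator \<phi> ` schwartz_space UNIV"
    by (auto simp: composition_operator_def comp_def smooth_functions_UNIV)
  moreover have "composition_operator \<phi> ` schwartz_space UNIV \<subseteq>
      composition_operator \<phi> ` smooth_functions UNIV \<inter> schwartz_space UNIV"
    using assms(1) schwartz_space_subset_smooth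
    by (auto simp: composition_operator_def schwartz_symbol_def)
  ultimately have "composition_operator \<phi> ` schwartz_space UNIV =
      composition_operator \<phi> ` smooth_functions UNIV \<inter> schwartz_space UNIV"
    by (rule subset_antisym[rotated])
  then show ?thesis
    using closedin_smooth_imp_closedin_schwartz[OF assms(3)] by simp
qed

end
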